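(* Let $k$ and $\ell$ be integers satisfying $0\leq\ell < k/2$, and let $1/2<\alpha'<\alpha\leq 1$. Let $f(x)=\frac{x+\sqrt{2x-1}}{2}$. Then for every $\gamma>0$ there is $n_0$ such that for all $n\geq n_0$ the following holds. Suppose that $(k-\ell)\mid n$, $\mathcal H$ is a $k$-uniform hypergraph on $n$ vertices, and $\delta_{k-1}(\mathcal H)\geq \alpha n$. Then $\mathcal H$ contains at least $$(1-\gamma)\cdot \frac{ f(\alpha')\,|E(\mathcal H)|}{n/(k-\ell)}$$ pairwise edge-disjoint Hamilton $\ell$-cycles.
   Context: For a $k$-uniform hypergraph $\mathcal H$ and a $(k-1)$-subset $A\subseteq V(\mathcal H)$, $d_{\mathcal H}(A)$ is the number of edges of $\mathcal H$ containing $A$, and $\delta_{k-1}(\mathcal H)$ is the minimum of $d_{\mathcal H}(A)$ over all $(k-1)$-subsets $A$ of $V(\mathcal H)$. For $0\leq \ell<k$, a $(k,\ell)$-cycle is a $k$-uniform hypergraph whose vertices can be ordered cyclically such that the edges are segments of $k$ consecutive vertices of that order and every two consecutive edges share exactly $\ell$ vertices. A Hamilton $\ell$-cycle of $\mathcal H$ is a sub-hypergraph of $\mathcal H$ which is a $(k,\ell)$-cycle on all vertices of $\mathcal H$ (for $\ell=0$, a perfect matching). Two Hamilton $\ell$-cycles are edge-disjoint if they share no edge. The paper writes the factor $(1-\gamma)$ as $(1-o(1))$ with $o(1)\to0$ as $n\to\infty$.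
   Formalization: The formal theorem assumes k ≥ 2; for k = 1, ℓ = 0 the claim as stated fails, since a 1-uniform hypergraph with at least αn but fewer than n edges has no perfect matching. *)

theory Defs
  imports Complex_Main
begin

definition uniform_hypergraph :: "nat \<Rightarrow> 'a set \<Rightarrow> 'a set set \<Rightarrow> bool" where
  "uniform_hypergraph k V E \<longleftrightarrow> finite V \<and> (\<forall>e\<in>E. e \<subseteq> V \<and> card e = k)"

definition hdegree :: "'a set set \<Rightarrow> 'a set \<Rightarrow> nat" where
  "hdegree E A = card {e \<in> E. A \<subseteq> e}"

text \<open>Meaningful when \<open>V\<close> is finite and \<open>card V \<ge> d\<close>, so that the minimum is over a finite nonempty set.\<close>

definition min_hdegree :: "nat \<Rightarrow> 'a set \<Rightarrow> 'a set set \<Rightarrow> nat" where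
  "min_hdegree d V E = Min (hdegree E ` {A. A \<subseteq> V \<and> card A = d})"

text \<open>The \<open>k\<close> consecutive vertices starting at position \<open>s\<close> in the cyclic order given by \<open>vs\<close>.\<close>

definition segment :: "'a list \<Rightarrow> nat \<Rightarrow> nat \<Rightarrow> 'a set" where
  "segment vs k s = {vs ! ((s + j) mod length vs) | j. j < k}"

text \<open>
  The list \<open>vs\<close> is the cyclic order of the vertices and \<open>ss\<close> lists the starting positions of the
  edges in the order in which they occur around it, so the edge after the last one is the first
  one. The condition \<open>\<Union>E = V\<close> says that the edges go all the way round the cycle. It is what makes
  a \<open>(k,0)\<close>-cycle a perfect matching rather than an arbitrary matching, and for \<open>l > 0\<close> it excludes
  two edges that meet on one side only (there, "first to second" and "second to first" are the same
  pair of sets).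
\<close>

definition kl_cycle :: "nat \<Rightarrow> nat \<Rightarrow> 'a set \<Rightarrow> 'a set set \<Rightarrow> bool" where
  "kl_cycle k l V E \<longleftrightarrow> uniform_hypergraph k V E \<and> \<Union>E = V \<and>
     (\<exists>vs ss. distinct vs \<and> set vs = V \<and>
        sorted_wrt (<) ss \<and> set ss \<subseteq> {..<length vs} \<and>
        E = segment vs k ` set ss \<and>
        (\<forall>i<length ss. \<forall>j<length ss. j = Suc i mod length ss \<and> i \<noteq> j \<longrightarrow>
           card (segment vs k (ss ! i) \<inter> segment vs k (ss ! j)) = l))"

text \<open>A Hamilton cycle spans \<open>V\<close>, so it is represented by its edge set \<open>C\<close>.\<close>

definition hamilton_cycle :: "nat \<Rightarrow> nat \<Rightarrow> 'a set \<Rightarrow> 'a set set \<Rightarrow> 'a set set \<Rightarrow> bool" where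
  "hamilton_cycle k l V E C \<longleftrightarrow> C \<subseteq> E \<and> kl_cycle k l V C"

definition f_reg :: "real \<Rightarrow> real" where
  "f_reg x = (x + sqrt (2 * x - 1)) / 2"

end

theory Submission
  imports Defs "HOL-Library.FuncSet" "HOL-Combinatorics.Transposition" "HOL-Real_Asymp.Real_Asymp"
begin

text \<open>
  Let \<open>d = k - l\<close> and \<open>n = d * m\<close>. An arrangement of the vertices in \<open>m\<close> blocks of length \<open>d\<close> yields a
  template: an \<open>m \<times> m\<close> bipartite graph whose rows are overlapping \<open>(k - 1)\<close>-sets, whose columns are the
  last vertices of the blocks, and whose entries are \<open>k\<close>-sets. Every perfect matching inside \<open>E\<close> is a
  Hamilton \<open>l\<close>-cycle, and for almost all arrangements the part of the template inside \<open>E\<close> has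
  minimum degree above \<open>m / 2\<close>, hence an \<open>f m\<close>-factor. Take about \<open>sqrt n / \<rho>\<close> such templates, where
  \<open>\<rho>\<close> is the probability that a template covers a given \<open>k\<close>-set, so that every \<open>k\<close>-set is covered at most
  \<open>q\<close> times with \<open>q\<close> close to \<open>sqrt n\<close>, and let every edge of the hypergraph choose one of the templates covering it.
  The edges retained by a template still satisfy the cut condition for an \<open>f m / q\<close>-factor, which
  splits into perfect matchings; the resulting cycles are edge-disjoint across all templates.
  Both random choices are derandomized by exponential potentials.
\<close>

section \<open>Disjoint perfect matchings in bipartite graphs\<close>

text \<open>One movable vertex per block makes matchings usable: since l < d, the movable position
  lies outside the overlap of consecutive edges, so permuting the columns changes how the blocks end
  and leaves the overlaps intact. The gap between \<alpha>' and \<alpha> is spent twice: on the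
  degrees of a random template, and on a surplus in every cut that is linear in m times the smaller
  side. Without that surplus the exponentially many cut conditions could not be controlled at once.
  The multiplicity q must lie well above log n, so that covering counts concentrate, and well below
  n / log n, so that exp(- c m / q) beats the polynomial number of templates; sqrt n is a convenient
  scale in between. About sqrt n / \<rho> templates yield about f m / sqrt n cycles each, together f
  m / \<rho>. As \<rho> is close to m^2 / (n choose k), this is about f (n choose k) / m, at least f
  |E| / m.\<close>

theorem hall_marriage:
  assumes "finite I" "\<And>i. i \<in> I \<Longrightarrow> finite (A i)"
    and "\<And>J. J \<subseteq> I \<Longrightarrow> card J \<le> card (\<Union>(A ` J))"
  shows "\<exists>R. inj_on R I \<and> (\<forall>i\<in>I. R i \<in> A i)"
  using assms
proof (induction "card I" arbitrary: I A rule: less_induct)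
  case less
  note fin = less.prems(1) and finA = less.prems(2) and hall = less.prems(3)
  show ?case
  proof (cases "I = {}")
    case True
    then show ?thesis by auto
  next
    case ne: False
    show ?thesis
    \<comment> \<open>A tight set J splits the problem: J is matched into its own neighbourhood T,
      and the rest keeps Hall's condition outside T because K \<union> J satisfies it and T has only
      \<open>card J\<close> elements. Without a tight proper subset each nonempty one has a spare
      neighbour, so a single index may take any of its values.\<close>
    proof (cases "\<exists>J. J \<subset> I \<and> J \<noteq> {} \<and> card (\<Union>(A ` J)) = card J")
      case True
      then obtain J where J: "J \<subset> I" "J \<noteq> {}" and eq: "card (\<Union>(A ` J)) = card J" by blast
      have finJ: "finite J" using J fin by (meson finite_subset psubset_imp_subset)
      have "\<exists>R. inj_on R J \<and> (\<forall>i\<in>J. R i \<in> A i)"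
        by (rule less.hyps) (use J fin finA hall finJ in \<open>auto intro: psubset_card_mono\<close>)
      then obtain R1 where R1: "inj_on R1 J" "\<And>i. i \<in> J \<Longrightarrow> R1 i \<in> A i" by auto
      define T where "T = \<Union>(A ` J)"
      have finT: "finite T" unfolding T_def using J finJ finA by auto
      have "\<exists>R. inj_on R (I - J) \<and> (\<forall>i\<in>I - J. R i \<in> A i - T)"
      proof (rule less.hyps)
        show "card (I - J) < card I"
          using J fin by (intro psubset_card_mono) auto
        show "card K \<le> card (\<Union>i\<in>K. A i - T)" if K: "K \<subseteq> I - J" for K
        proof -
          have finK: "finite K" using K fin by (meson finite_Diff finite_subset)
          have "card K + card J = card (K \<union> J)"
            using K finK finJ by (subst card_Un_disjoint) auto
          also have "\<dots> \<le> card (\<Union>(A ` (K \<union> J)))" using K J by (intro hall) auto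
          also have "\<Union>(A ` (K \<union> J)) = (\<Union>i\<in>K. A i - T) \<union> T" unfolding T_def by auto
          also have "card \<dots> \<le> card (\<Union>i\<in>K. A i - T) + card T" by (rule card_Un_le)
          finally show ?thesis using eq T_def by simp
        qed
      qed (use fin finA in auto)
      then obtain R2 where R2: "inj_on R2 (I - J)" "\<And>i. i \<in> I - J \<Longrightarrow> R2 i \<in> A i - T" by blast
      have R1T: "R1 i \<in> T" if "i \<in> J" for i using R1 that T_def by auto
      define R where "R i = (if i \<in> J then R1 i else R2 i)" for i
      have "inj_on R I"
      proof (rule inj_onI)
        fix x y assume "x \<in> I" "y \<in> I" "R x = R y"
        moreover have "R2 i \<notin> T" if "i \<in> I - J" for i using R2(2)[OF that] by auto
        ultimately show "x = y"
          using inj_onD[OF R1(1), of x y] inj_onD[OF R2(1), of x y] R1T unfolding R_def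
          by (cases "x \<in> J"; cases "y \<in> J") (auto, (metis (full_types))+)
      qed
      moreover have "\<forall>i\<in>I. R i \<in> A i" using R1 R2 unfolding R_def by auto
      ultimately show ?thesis by blast
    next
      case False
      obtain i where i: "i \<in> I" using ne by auto
      have "A i \<noteq> {}" using hall[of "{i}"] i by auto
      then obtain a where a: "a \<in> A i" by auto
      have "\<exists>R. inj_on R (I - {i}) \<and> (\<forall>x\<in>I - {i}. R x \<in> A x - {a})"
      proof (rule less.hyps)
        show "card (I - {i}) < card I" using i fin by (meson card_Diff1_less)
        show "card K \<le> card (\<Union>x\<in>K. A x - {a})" if K: "K \<subseteq> I - {i}" for K
        proof (cases "K = {}")
          case Kne: False
          have "K \<subset> I" using K i by auto
          then have "card K < card (\<Union>(A ` K))"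
            using False Kne hall[of K] by (metis le_neq_implies_less psubset_imp_subset)
          also have "\<Union>(A ` K) \<subseteq> insert a (\<Union>x\<in>K. A x - {a})" by auto
          then have "card (\<Union>(A ` K)) \<le> card (insert a (\<Union>x\<in>K. A x - {a}))"
            using finite_subset[OF K] K fin finA by (intro card_mono) auto
          also have "\<dots> \<le> Suc (card (\<Union>x\<in>K. A x - {a}))" by (rule card_insert_le_m1) auto
          finally show ?thesis by simp
        qed auto
      qed (use fin finA in auto)
      then obtain R where R: "inj_on R (I - {i})" "\<And>x. x \<in> I - {i} \<Longrightarrow> R x \<in> A x - {a}" by blast
      have "inj_on (R(i := a)) I"
      proof (rule inj_onI)
        fix x y assume "x \<in> I" "y \<in> I" "(R(i := a)) x = (R(i := a)) y"
        moreover have "R x \<noteq> a" if "x \<in> I - {i}" for x using R(2)[OF that] by auto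
        ultimately show "x = y" using inj_onD[OF R(1), of x y] by (auto split: if_splits)
      qed
      moreover have "\<forall>x\<in>I. (R(i := a)) x \<in> A x" using R a by auto
      ultimately show ?thesis by blast
    qed
  qed
qed

section \<open>Regular factors of bipartite graphs and their decomposition\<close>

definition biregular :: "nat \<Rightarrow> 'i set \<Rightarrow> 'y set \<Rightarrow> ('i \<times> 'y) set \<Rightarrow> bool" where
  "biregular r I Y F \<longleftrightarrow> F \<subseteq> I \<times> Y \<and> (\<forall>i\<in>I. card {e \<in> F. fst e = i} = r) \<and>
     (\<forall>y\<in>Y. card {e \<in> F. snd e = y} = r)"

lemma card_by_fst:
  assumes "finite I" "finite G" "G \<subseteq> I \<times> Y" "A \<subseteq> I"
  shows "(\<Sum>i\<in>A. card {e \<in> G. fst e = i}) = card {e \<in> G. fst e \<in> A}"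
proof -
  have "{e \<in> G. fst e \<in> A} = (\<Union>i\<in>A. {e \<in> G. fst e = i})" by auto
  moreover have "card \<dots> = (\<Sum>i\<in>A. card {e \<in> G. fst e = i})"
    by (rule card_UN_disjoint) (use assms in \<open>auto intro: finite_subset\<close>)
  ultimately show ?thesis by simp
qed

lemma card_by_snd:
  assumes "finite Y" "finite G" "G \<subseteq> I \<times> Y" "B \<subseteq> Y"
  shows "(\<Sum>y\<in>B. card {e \<in> G. snd e = y}) = card {e \<in> G. snd e \<in> B}"
proof -
  have "{e \<in> G. snd e \<in> B} = (\<Union>y\<in>B. {e \<in> G. snd e = y})" by auto
  moreover have "card \<dots> = (\<Sum>y\<in>B. card {e \<in> G. snd e = y})"
    by (rule card_UN_disjoint) (use assms in \<open>auto intro: finite_subset\<close>)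
  ultimately show ?thesis by simp
qed

text \<open>Regularity gives Hall's condition by counting: the edges at J all end in its
  neighbourhood, which receives no more edges per vertex than each vertex of J emits. Deleting the
  matching lowers every degree by one, and deleted edges cannot be reused.\<close>

lemma biregular_matchings:
  assumes "finite I" "finite Y" "card I = card Y" "biregular r I Y F"
  shows "\<exists>\<sigma>. (\<forall>c<r. bij_betw (\<sigma> c) I Y \<and> (\<forall>i\<in>I. (i, \<sigma> c i) \<in> F)) \<and>
     (\<forall>c<r. \<forall>c'<r. c \<noteq> c' \<longrightarrow> (\<forall>i\<in>I. \<sigma> c i \<noteq> \<sigma> c' i))"
  using assms(4)
proof (induction r arbitrary: F)
  case 0
  then show ?case by auto
next
  case (Suc r)
  have F: "F \<subseteq> I \<times> Y" and rI: "\<And>i. i \<in> I \<Longrightarrow> card {e \<in> F. fst e = i} = Suc r"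
    and rY: "\<And>y. y \<in> Y \<Longrightarrow> card {e \<in> F. snd e = y} = Suc r"
    using Suc.prems unfolding biregular_def by auto
  have finF: "finite F" using F assms(1,2) by (meson finite_SigmaI finite_subset)
  have "\<exists>R. inj_on R I \<and> (\<forall>i\<in>I. R i \<in> {y. (i, y) \<in> F})"
  proof (rule hall_marriage)
    show "finite {y. (i, y) \<in> F}" if "i \<in> I" for i
      using F assms(2) by (auto intro: finite_subset[of _ Y])
    fix J assume J: "J \<subseteq> I"
    define B where "B = (\<Union>i\<in>J. {y. (i, y) \<in> F})"
    have B: "B \<subseteq> Y" using F B_def by auto
    have "Suc r * card J = (\<Sum>i\<in>J. card {e \<in> F. fst e = i})" using J rI by (simp add: subset_iff)
    also have "\<dots> = card {e \<in> F. fst e \<in> J}" by (rule card_by_fst) (use assms F finF J in auto)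
    also have "\<dots> \<le> card {e \<in> F. snd e \<in> B}"
      by (rule card_mono) (use finF B_def in auto)
    also have "\<dots> = (\<Sum>y\<in>B. card {e \<in> F. snd e = y})"
      by (rule card_by_snd[symmetric]) (use assms F finF B in auto)
    also have "\<dots> = Suc r * card B" using B rY by (simp add: subset_iff)
    finally show "card J \<le> card (\<Union>i\<in>J. {y. (i, y) \<in> F})"
      unfolding B_def using mult_le_cancel1[of "Suc r"] by simp
  qed (use assms in auto)
  then obtain R where R: "inj_on R I" "\<And>i. i \<in> I \<Longrightarrow> (i, R i) \<in> F" by auto
  have RY: "R ` I \<subseteq> Y" using R F by auto
  have bij: "bij_betw R I Y"
    using R RY assms(2,3) by (simp add: bij_betw_def card_image card_subset_eq)
  define F' where "F' = {e \<in> F. snd e \<noteq> R (fst e)}"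
  have "biregular r I Y F'"
    unfolding biregular_def
  proof (intro conjI ballI)
    show "F' \<subseteq> I \<times> Y" using F F'_def by auto
    fix i assume i: "i \<in> I"
    have "{e \<in> F'. fst e = i} = {e \<in> F. fst e = i} - {(i, R i)}"
      unfolding F'_def by (auto simp: prod_eq_iff)
    moreover have "(i, R i) \<in> {e \<in> F. fst e = i}" using R(2)[OF i] by auto
    ultimately show "card {e \<in> F'. fst e = i} = r" using rI[OF i] finF by (simp add: card_Diff_singleton)
  next
    fix y assume y: "y \<in> Y"
    obtain i where i: "i \<in> I" "R i = y" using bij y unfolding bij_betw_def by auto
    have "{e \<in> F'. snd e = y} = {e \<in> F. snd e = y} - {(i, y)}"
    proof -
      have "fst e = i \<longleftrightarrow> R (fst e) = y" if "e \<in> F" for e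
        using that F i inj_onD[OF R(1), of "fst e" i] by auto
      then show ?thesis unfolding F'_def using i(2) by (auto simp: prod_eq_iff)
    qed
    moreover have "(i, y) \<in> {e \<in> F. snd e = y}" using R(2)[OF i(1)] i by auto
    ultimately show "card {e \<in> F'. snd e = y} = r" using rY[OF y] finF by (simp add: card_Diff_singleton)
  qed
  from Suc.IH[OF this] obtain \<sigma> where
    s1: "\<forall>c<r. bij_betw (\<sigma> c) I Y \<and> (\<forall>i\<in>I. (i, \<sigma> c i) \<in> F')" and
    s2: "\<forall>c<r. \<forall>c'<r. c \<noteq> c' \<longrightarrow> (\<forall>i\<in>I. \<sigma> c i \<noteq> \<sigma> c' i)" by blast
  have ne: "\<sigma> c i \<noteq> R i" "R i \<noteq> \<sigma> c i" if "c < r" "i \<in> I" for c i using s1 that unfolding F'_def by force+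
  show ?case
    by (rule exI[of _ "\<lambda>c. if c = r then R else \<sigma> c"])
      (use s1 s2 ne bij R F'_def in \<open>auto simp: less_Suc_eq\<close>)
qed

text \<open>
  Tutte's gadget reduces the existence of an \<open>r\<close>-factor to Hall's theorem: every edge is split into
  its two ends, which may be matched to each other (the edge is in the factor) or to one of the
  \<open>deg v - r\<close> dummies at the endpoint \<open>v\<close>.
\<close>

theorem biregular_subgraph:
  assumes finI: "finite I" and finY: "finite Y" and IY: "card I = card Y" and G: "G \<subseteq> I \<times> Y"
    and cut: "\<And>A B. A \<subseteq> I \<Longrightarrow> B \<subseteq> Y \<Longrightarrow>
      r * (card A + card B) \<le> card (G \<inter> A \<times> B) + r * card I"
  shows "\<exists>F\<subseteq>G. biregular r I Y F"
proof -
  have finG: "finite G" using G finI finY by (meson finite_SigmaI finite_subset)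
  define dI where "dI i = card {e \<in> G. fst e = i}" for i
  define dY where "dY y = card {e \<in> G. snd e = y}" for y
  have dI: "r \<le> dI i" if "i \<in> I" for i
  proof -
    have "G \<inter> {i} \<times> Y = {e \<in> G. fst e = i}" using G by auto
    then show ?thesis using cut[of "{i}" Y] that IY unfolding dI_def by simp
  qed
  have dY: "r \<le> dY y" if "y \<in> Y" for y
  proof -
    have "G \<inter> I \<times> {y} = {e \<in> G. snd e = y}" using G by auto
    then show ?thesis using cut[of I "{y}"] that IY unfolding dY_def by simp
  qed
  define DI where "DI = (SIGMA i:I. {..<dI i - r})"
  define DY where "DY = (SIGMA y:Y. {..<dY y - r})"
  have fD: "finite DI" "finite DY" using finI finY unfolding DI_def DY_def by auto
  define L where "L = Inl ` G \<union> Inr ` DY"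
  define N :: "('a \<times> 'b) + ('b \<times> nat) \<Rightarrow> (('a \<times> 'b) + ('a \<times> nat)) set" where "N = (\<lambda>u. case u of
      Inl e \<Rightarrow> insert (Inl e) (Inr ` ({fst e} \<times> {..<dI (fst e) - r}))
    | Inr (y, c) \<Rightarrow> Inl ` {e \<in> G. snd e = y})"
  define Rt where "Rt = Inl ` G \<union> Inr ` DI"
  have NR: "N u \<subseteq> Rt" if "u \<in> L" for u
    using that G unfolding L_def N_def Rt_def DI_def DY_def by (auto split: sum.splits)
  have finL: "finite L" "finite Rt" using finG fD unfolding L_def Rt_def by auto
  have sumI: "(\<Sum>i\<in>A. dI i) = card {e \<in> G. fst e \<in> A}" if "A \<subseteq> I" for A
    unfolding dI_def by (rule card_by_fst) (use finI finG G that in auto)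
  have sumY: "(\<Sum>y\<in>B. dY y) = card {e \<in> G. snd e \<in> B}" if "B \<subseteq> Y" for B
    unfolding dY_def by (rule card_by_snd) (use finY finG G that in auto)
  have cDI: "card (SIGMA i:A. {..<dI i - r}) + r * card A = card {e \<in> G. fst e \<in> A}" if "A \<subseteq> I" for A
  proof -
    have "finite A" using that finI finite_subset by auto
    then have "card (SIGMA i:A. {..<dI i - r}) + r * card A = (\<Sum>i\<in>A. (dI i - r) + r)"
      by (simp add: card_SigmaI sum.distrib)
    also have "\<dots> = (\<Sum>i\<in>A. dI i)" using that dI by (intro sum.cong) auto
    finally show ?thesis using sumI that by simp
  qed
  have cDY: "card (SIGMA y:B. {..<dY y - r}) + r * card B = card {e \<in> G. snd e \<in> B}" if "B \<subseteq> Y" for B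
  proof -
    have "finite B" using that finY finite_subset by auto
    then have "card (SIGMA y:B. {..<dY y - r}) + r * card B = (\<Sum>y\<in>B. (dY y - r) + r)"
      by (simp add: card_SigmaI sum.distrib)
    also have "\<dots> = (\<Sum>y\<in>B. dY y)" using that dY by (intro sum.cong) auto
    finally show ?thesis using sumY that by simp
  qed
  have "\<exists>R. inj_on R L \<and> (\<forall>u\<in>L. R u \<in> N u)"
  proof (rule hall_marriage)
    show "finite L" by fact
    show "finite (N u)" if "u \<in> L" for u using NR[OF that] finL finite_subset by auto
    fix J assume J: "J \<subseteq> L"
    define J1 where "J1 = {e. Inl e \<in> J}"
    define J2 where "J2 = {p. Inr p \<in> J}"
    have J12: "J = Inl ` J1 \<union> Inr ` J2"
    proof (rule set_eqI)
      show "u \<in> J \<longleftrightarrow> u \<in> Inl ` J1 \<union> Inr ` J2" for u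
        unfolding J1_def J2_def by (cases u) auto
    qed
    have J1: "J1 \<subseteq> G" and J2: "J2 \<subseteq> DY" using J unfolding J1_def J2_def L_def by auto
    have fJ: "finite J1" "finite J2" using finite_subset[OF J1 finG] finite_subset[OF J2 fD(2)] by auto
    define A where "A = fst ` J1"
    define B where "B = fst ` J2"
    have A: "A \<subseteq> I" and B: "B \<subseteq> Y" using J1 J2 G unfolding A_def B_def DY_def by auto
    define M1 where "M1 = J1 \<union> {e \<in> G. snd e \<in> B}"
    define M2 where "M2 = (SIGMA i:A. {..<dI i - r})"
    have fM: "finite M1" "finite M2" using fJ finG finite_subset[OF A finI]
      unfolding M1_def M2_def by auto
    have UN: "\<Union>(N ` J) = Inl ` M1 \<union> Inr ` M2"
      unfolding J12 M1_def M2_def A_def B_def N_def by (force split: sum.splits)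
    have cN: "card (\<Union>(N ` J)) = card M1 + card M2"
      unfolding UN using fM by (subst card_Un_disjoint) (auto simp: card_image)
    have cJ: "card J = card J1 + card J2"
      unfolding J12 using fJ by (subst card_Un_disjoint) (auto simp: card_image)
    have "J2 \<subseteq> (SIGMA y:B. {..<dY y - r})" using J2 unfolding B_def DY_def by force
    then have "card J2 \<le> card (SIGMA y:B. {..<dY y - r})"
      using finite_subset[OF B finY] by (intro card_mono) auto
    then have cJ2: "card J2 + r * card B \<le> card {e \<in> G. snd e \<in> B}" using cDY[OF B] by simp
    have cM2: "card M2 + r * card A = card {e \<in> G. fst e \<in> A}" unfolding M2_def by (rule cDI[OF A])
    have "card M1 + card (J1 \<inter> {e \<in> G. snd e \<in> B}) = card J1 + card {e \<in> G. snd e \<in> B}"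
      unfolding M1_def using card_Un_Int[of J1 "{e \<in> G. snd e \<in> B}"] fJ finG by simp
    moreover have "card (J1 \<inter> {e \<in> G. snd e \<in> B}) \<le> card (G \<inter> A \<times> B)"
      by (rule card_mono) (use finG J1 A_def in \<open>auto simp: image_iff, force\<close>)
    moreover have "card {e \<in> G. fst e \<in> A} = card (G \<inter> A \<times> B) + card (G \<inter> A \<times> (Y - B))"
    proof -
      have "{e \<in> G. fst e \<in> A} = (G \<inter> A \<times> B) \<union> (G \<inter> A \<times> (Y - B))" using G by auto
      then show ?thesis using finG by (simp add: card_Un_disjoint disjoint_iff)
    qed
    \<comment> \<open>After cancellation Hall's condition for J reads r * card A - r * card B \<le>
      card (G \<inter> A \<times> (Y - B)). This is the cut condition for A and the complement of
      B.\<close>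
    moreover have "r * (card A + card (Y - B)) \<le> card (G \<inter> A \<times> (Y - B)) + r * card I"
      by (rule cut) (use A in auto)
    moreover have "card (Y - B) + card B = card I"
      using B finY IY by (metis card_Diff_subset card_mono finite_subset le_add_diff_inverse2)
    then have "r * card (Y - B) + r * card B = r * card I" by (metis distrib_left)
    ultimately show "card J \<le> card (\<Union>(N ` J))"
      unfolding cN cJ using cJ2 cM2 by (simp add: distrib_left)
  qed
  then obtain R where inj: "inj_on R L" and R: "\<And>u. u \<in> L \<Longrightarrow> R u \<in> N u" by blast
  \<comment> \<open>Both sides have twice the number of edges minus r * card I elements, so a
    matching that saturates \<open>L\<close> is onto \<open>Rt\<close>. That all dummies on both
    sides are used is what makes the degrees exactly r.\<close>
  have "card L = card Rt"
  proof -
    have "card L = card G + card DY" "card Rt = card G + card DI"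
      unfolding L_def Rt_def using finG fD by (subst card_Un_disjoint; auto simp: card_image)+
    moreover have "{e \<in> G. fst e \<in> I} = G" "{e \<in> G. snd e \<in> Y} = G" using G by auto
    ultimately show ?thesis using cDI[of I] cDY[of Y] IY unfolding DI_def DY_def by simp
  qed
  then have surj: "R ` L = Rt"
    using inj NR R finL by (intro card_subset_eq) (auto simp: card_image)
  define F where "F = {e \<in> G. R (Inl e) = Inl e}"
  have InlR: "R (Inl e) = Inl e \<or> (\<exists>c<dI (fst e) - r. R (Inl e) = Inr (fst e, c))" if "e \<in> G" for e
    using R[of "Inl e"] that unfolding L_def N_def by auto
  have InrR: "\<exists>e\<in>G. snd e = y \<and> R (Inr (y, c)) = Inl e" if "(y, c) \<in> DY" for y c
    using R[of "Inr (y, c)"] that unfolding L_def N_def by auto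
  have "biregular r I Y F"
    unfolding biregular_def
  proof (intro conjI ballI)
    show "F \<subseteq> I \<times> Y" using G unfolding F_def by auto
    fix i assume i: "i \<in> I"
    define U where "U = {e \<in> G. fst e = i \<and> e \<notin> F}"
    have "(\<lambda>e. R (Inl e)) ` U = Inr ` ({i} \<times> {..<dI i - r})"
    proof (intro equalityI subsetI)
      fix z assume "z \<in> (\<lambda>e. R (Inl e)) ` U"
      then show "z \<in> Inr ` ({i} \<times> {..<dI i - r})" using InlR unfolding U_def F_def by fastforce
    next
      fix z :: "('a \<times> 'b) + ('a \<times> nat)" assume "z \<in> Inr ` ({i} \<times> {..<dI i - r})"
      then obtain c where c: "c < dI i - r" "z = Inr (i, c)" by auto
      then have "z \<in> R ` L" using i unfolding surj Rt_def DI_def by auto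
      then obtain u where u: "u \<in> L" "z = R u" by auto
      show "z \<in> (\<lambda>e. R (Inl e)) ` U"
      proof (cases u)
        case (Inl e)
        then have "e \<in> G" using u unfolding L_def by auto
        then have "e \<in> U" "z = R (Inl e)" using InlR[of e] u c Inl unfolding U_def F_def by auto
        then show ?thesis by blast
      next
        case (Inr p)
        then show ?thesis using u c InrR[of "fst p" "snd p"] unfolding L_def by auto
      qed
    qed
    then have "card ((\<lambda>e. R (Inl e)) ` U) = dI i - r" by (simp add: card_image card_cartesian_product)
    moreover have "inj_on (\<lambda>e. R (Inl e)) U"
      using inj unfolding inj_on_def L_def U_def by blast
    ultimately have cU: "card U = dI i - r" by (simp add: card_image)
    have "{e \<in> G. fst e = i} = {e \<in> F. fst e = i} \<union> U" unfolding U_def F_def by auto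
    moreover have "{e \<in> F. fst e = i} \<inter> U = {}" unfolding U_def by auto
    moreover have "finite F" "finite U" using finG unfolding F_def U_def by auto
    ultimately have "dI i = card {e \<in> F. fst e = i} + card U"
      unfolding dI_def by (simp add: card_Un_disjoint)
    then show "card {e \<in> F. fst e = i} = r" using cU dI[OF i] by simp
  next
    fix y assume y: "y \<in> Y"
    define U where "U = {e \<in> G. snd e = y \<and> e \<notin> F}"
    have "R ` Inr ` ({y} \<times> {..<dY y - r}) = Inl ` U"
    proof (intro equalityI subsetI)
      fix z assume "z \<in> R ` Inr ` ({y} \<times> {..<dY y - r})"
      then obtain c where c: "c < dY y - r" "z = R (Inr (y, c))" by auto
      then have cD: "(y, c) \<in> DY" using y unfolding DY_def by auto
      obtain e where e: "e \<in> G" "snd e = y" "z = Inl e" using InrR[OF cD] c by auto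
      have "R (Inl e) \<noteq> Inl e"
      proof
        assume "R (Inl e) = Inl e"
        then have "R (Inl e) = R (Inr (y, c))" using e c by simp
        then have "Inl e = (Inr (y, c) :: ('a \<times> 'b) + ('b \<times> nat))"
          using inj cD e unfolding inj_on_def L_def by blast
        then show False by simp
      qed
      then show "z \<in> Inl ` U" using e unfolding U_def F_def by auto
    next
      fix z :: "('a \<times> 'b) + ('a \<times> nat)" assume "z \<in> Inl ` U"
      then obtain e where e: "e \<in> G" "snd e = y" "e \<notin> F" "z = Inl e" unfolding U_def by auto
      then have "z \<in> R ` L" unfolding surj Rt_def by auto
      then obtain u where u: "u \<in> L" "z = R u" by auto
      show "z \<in> R ` Inr ` ({y} \<times> {..<dY y - r})"
      proof (cases u)
        case (Inl e')
        then have "e' \<in> G" using u unfolding L_def by auto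
        then show ?thesis using InlR[of e'] u e Inl unfolding F_def by auto
      next
        case (Inr p)
        then have "(fst p, snd p) \<in> DY" using u unfolding L_def by auto
        moreover from InrR[OF this] have "fst p = y" using u e Inr by auto
        ultimately have "p \<in> {y} \<times> {..<dY y - r}" unfolding DY_def by (auto simp: mem_Times_iff)
        then show ?thesis using u Inr by auto
      qed
    qed
    moreover have "inj_on R (Inr ` ({y} \<times> {..<dY y - r}))"
      by (rule inj_on_subset[OF inj]) (use y in \<open>auto simp: L_def DY_def\<close>)
    ultimately have "card (Inr ` ({y} \<times> {..<dY y - r}) :: (('a \<times> 'b) + ('b \<times> nat)) set)
        = card (Inl ` U :: (('a \<times> 'b) + ('a \<times> nat)) set)"
      by (metis card_image)
    then have cU: "card U = dY y - r" by (simp add: card_image card_cartesian_product)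
    have "{e \<in> G. snd e = y} = {e \<in> F. snd e = y} \<union> U" unfolding U_def F_def by auto
    moreover have "{e \<in> F. snd e = y} \<inter> U = {}" unfolding U_def by auto
    moreover have "finite F" "finite U" using finG unfolding F_def U_def by auto
    ultimately have "dY y = card {e \<in> F. snd e = y} + card U"
      unfolding dY_def by (simp add: card_Un_disjoint)
    then show "card {e \<in> F. snd e = y} = r" using cU dY[OF y] by simp
  qed
  moreover have "F \<subseteq> G" unfolding F_def by auto
  ultimately show ?thesis by blast
qed

corollary disjoint_matchings:
  assumes "finite I" "finite Y" "card I = card Y" "G \<subseteq> I \<times> Y"
    and "\<And>A B. A \<subseteq> I \<Longrightarrow> B \<subseteq> Y \<Longrightarrow>
      r * (card A + card B) \<le> card (G \<inter> A \<times> B) + r * card I"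
  shows "\<exists>\<sigma>. (\<forall>c<r. bij_betw (\<sigma> c) I Y \<and> (\<forall>i\<in>I. (i, \<sigma> c i) \<in> G)) \<and>
     (\<forall>c<r. \<forall>c'<r. c \<noteq> c' \<longrightarrow> (\<forall>i\<in>I. \<sigma> c i \<noteq> \<sigma> c' i))"
proof -
  obtain F where F: "F \<subseteq> G" "biregular r I Y F"
    using biregular_subgraph[OF assms] by blast
  show ?thesis using biregular_matchings[OF assms(1-3) F(2)] F(1) by blast
qed

section \<open>Derandomized choices\<close>

lemma exists_le_average:
  fixes g :: "'x \<Rightarrow> real" and M :: real
  assumes "finite S" "S \<noteq> {}" "(\<Sum>x\<in>S. g x) \<le> card S * M"
  shows "\<exists>x\<in>S. g x \<le> M"
proof (rule ccontr)
  assume "\<not> (\<exists>x\<in>S. g x \<le> M)"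
  then have "(\<Sum>x\<in>S. M) < (\<Sum>x\<in>S. g x)" using assms(1,2) by (intro sum_strict_mono) auto
  then show False using assms(3) by simp
qed

text \<open>For a uniformly random next element of P, each summand gains the factor 1 + \<eta> with
  probability at most \<rho>. Hence the mean of the potential grows at most by 1 + \<eta> \<rho>,
  and some element does no worse than the mean.\<close>

lemma balanced_sequence_potential:
  fixes cov :: "'p \<Rightarrow> 'e set" and \<rho> \<eta> :: real and N :: nat
  assumes "finite P" "P \<noteq> {}" "finite K" "\<eta> \<ge> 0"
    and cov: "\<And>e. e \<in> K \<Longrightarrow> card {x \<in> P. e \<in> cov x} \<le> \<rho> * card P"
  shows "\<exists>p. (\<forall>t. p t \<in> P) \<and>
    (\<Sum>e\<in>K. (1 + \<eta>) ^ card {t. t < N \<and> e \<in> cov (p t)}) \<le> card K * (1 + \<eta> * \<rho>) ^ N"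
proof (induction N)
  case 0
  then show ?case using assms(2) by auto
next
  case (Suc N)
  then obtain p where p: "\<forall>t. p t \<in> P"
    "(\<Sum>e\<in>K. (1 + \<eta>) ^ card {t. t < N \<and> e \<in> cov (p t)}) \<le> card K * (1 + \<eta> * \<rho>) ^ N" by blast
  define W where "W e = (1 + \<eta>) ^ card {t. t < N \<and> e \<in> cov (p t)}" for e
  have W0: "W e \<ge> 0" for e unfolding W_def using assms(4) by simp
  have "(\<Sum>x\<in>P. \<Sum>e\<in>K. W e * (1 + \<eta> * of_bool (e \<in> cov x)))
      = (\<Sum>e\<in>K. W e * (card P + \<eta> * card {x \<in> P. e \<in> cov x}))"
  proof (subst sum.swap, intro sum.cong refl)
    fix e assume "e \<in> K"
    have "(\<Sum>x\<in>P. of_bool (e \<in> cov x)) = (real (card {x \<in> P. e \<in> cov x}))"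
      using assms(1) by (simp add: of_bool_def sum.If_cases Int_def)
    then show "(\<Sum>x\<in>P. W e * (1 + \<eta> * of_bool (e \<in> cov x)))
        = W e * (card P + \<eta> * card {x \<in> P. e \<in> cov x})"
      by (simp add: sum_distrib_left[symmetric] sum.distrib)
  qed
  also have "\<dots> \<le> (\<Sum>e\<in>K. W e * (card P + \<eta> * (\<rho> * card P)))"
    using cov W0 assms(4) by (intro sum_mono mult_left_mono add_left_mono) auto
  also have "\<dots> = card P * ((\<Sum>e\<in>K. W e) * (1 + \<eta> * \<rho>))"
    by (simp add: sum_distrib_right algebra_simps sum.distrib sum_distrib_left)
  finally obtain x where x: "x \<in> P"
    "(\<Sum>e\<in>K. W e * (1 + \<eta> * of_bool (e \<in> cov x))) \<le> (\<Sum>e\<in>K. W e) * (1 + \<eta> * \<rho>)"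
    using exists_le_average[OF assms(1,2)] by blast
  define p' where "p' = p(N := x)"
  have step: "(1 + \<eta>) ^ card {t. t < Suc N \<and> e \<in> cov (p' t)} = W e * (1 + \<eta> * of_bool (e \<in> cov x))" for e
  proof -
    have "{t. t < Suc N \<and> e \<in> cov (p' t)} =
        (if e \<in> cov x then insert N {t. t < N \<and> e \<in> cov (p t)} else {t. t < N \<and> e \<in> cov (p t)})"
      unfolding p'_def by (auto simp: less_Suc_eq)
    then show ?thesis unfolding W_def by auto
  qed
  show ?case
  proof (intro exI conjI)
    show "\<forall>t. p' t \<in> P" using p x p'_def by auto
    have "K = {} \<or> 1 + \<eta> * \<rho> \<ge> 0"
    proof (cases "K = {}")
      case False
      then obtain e where "e \<in> K" by auto
      then have "0 \<le> \<rho> * card P" using cov[of e] by (meson of_nat_0_le_iff order_trans)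
      then have "\<rho> \<ge> 0" using assms(1,2) by (simp add: zero_le_mult_iff card_gt_0_iff)
      then show ?thesis using assms(4) by simp
    qed simp
    then show "(\<Sum>e\<in>K. (1 + \<eta>) ^ card {t. t < Suc N \<and> e \<in> cov (p' t)})
        \<le> card K * (1 + \<eta> * \<rho>) ^ Suc N"
    proof
      assume "1 + \<eta> * \<rho> \<ge> 0"
      then have "(\<Sum>e\<in>K. W e) * (1 + \<eta> * \<rho>) \<le> (card K * (1 + \<eta> * \<rho>) ^ N) * (1 + \<eta> * \<rho>)"
        using p(2) unfolding W_def by (intro mult_right_mono) auto
      then show ?thesis using x(2) step by (simp add: mult_ac)
    qed simp
  qed
qed

text \<open>A single summand is at most the whole potential; taking logarithms and using ln (1 +
  \<eta>) \<ge> \<eta> (1 - \<eta>) gives the bound. The term with ln (card K) is the price for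
  treating all of K simultaneously.\<close>

lemma balanced_sequence:
  fixes cov :: "'p \<Rightarrow> 'e set" and \<rho> \<eta> :: real and N :: nat
  assumes "finite P" "P \<noteq> {}" "finite K" "0 < \<eta>" "\<eta> < 1"
    and cov: "\<And>e. e \<in> K \<Longrightarrow> card {x \<in> P. e \<in> cov x} \<le> \<rho> * card P"
  shows "\<exists>p. (\<forall>t. p t \<in> P) \<and>
    (\<forall>e\<in>K. real (card {t. t < N \<and> e \<in> cov (p t)}) \<le> (ln (card K) / \<eta> + \<rho> * N) / (1 - \<eta>))"
proof -
  obtain p where p: "\<forall>t. p t \<in> P"
    "(\<Sum>e\<in>K. (1 + \<eta>) ^ card {t. t < N \<and> e \<in> cov (p t)}) \<le> card K * (1 + \<eta> * \<rho>) ^ N"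
    using balanced_sequence_potential[of P K \<eta> cov \<rho> N] assms by auto
  have "real (card {t. t < N \<and> e \<in> cov (p t)}) \<le> (ln (card K) / \<eta> + \<rho> * N) / (1 - \<eta>)" if e: "e \<in> K" for e
  proof -
    define d where "d = card {t. t < N \<and> e \<in> cov (p t)}"
    have cK: "card K > 0" using e assms(3) card_gt_0_iff by auto
    have "0 \<le> \<rho> * card P" using cov[OF e] by (meson of_nat_0_le_iff order_trans)
    then have \<rho>: "\<rho> \<ge> 0" using assms(1,2) by (simp add: zero_le_mult_iff card_gt_0_iff)
    have "(1 + \<eta>) ^ d \<le> (\<Sum>e\<in>K. (1 + \<eta>) ^ card {t. t < N \<and> e \<in> cov (p t)})"
      unfolding d_def using e assms(3,4) by (intro member_le_sum) auto
    also have "\<dots> \<le> card K * (1 + \<eta> * \<rho>) ^ N" by (rule p(2))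
    also have "\<dots> \<le> card K * exp (\<eta> * \<rho>) ^ N"
      using \<rho> assms(4) by (intro mult_left_mono power_mono exp_ge_add_one_self) auto
    finally have "ln ((1 + \<eta>) ^ d) \<le> ln (card K * exp (\<eta> * \<rho>) ^ N)"
      using assms(4) cK by (subst ln_le_cancel_iff) auto
    then have "d * ln (1 + \<eta>) \<le> ln (card K) + N * (\<eta> * \<rho>)"
      using cK assms(4) by (simp add: ln_mult ln_realpow)
    moreover have "\<eta> * (1 - \<eta>) \<le> ln (1 + \<eta>)"
      using ln_one_plus_pos_lower_bound[of \<eta>] assms(4,5) by (simp add: algebra_simps power2_eq_square)
    then have "d * (\<eta> * (1 - \<eta>)) \<le> d * ln (1 + \<eta>)" by (intro mult_left_mono) auto
    ultimately have "d * (\<eta> * (1 - \<eta>)) \<le> ln (card K) + N * (\<eta> * \<rho>)" by linarith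
    then show ?thesis unfolding d_def[symmetric] using assms(4,5) by (simp add: field_simps)
  qed
  then show ?thesis using p(1) by blast
qed

text \<open>If every e chooses uniformly from \<open>Ch e\<close>, an element of \<open>Q h\<close>
  picks \<open>\<tau> h\<close> with probability at least 1 / q, so its factor is on average at most
  1 - s / q. The choices are fixed one element at a time. The weights are arbitrary so that the
  factor earned by a fixed element can be absorbed into them.\<close>

lemma assignment_potential:
  fixes w :: "'h \<Rightarrow> real" and s q :: real
  assumes "finite E" "finite H" "0 \<le> s" "s \<le> 1"
    and Ch: "\<And>e. e \<in> E \<Longrightarrow> finite (Ch e) \<and> Ch e \<noteq> {} \<and> card (Ch e) \<le> q"
    and Q: "\<And>h e. h \<in> H \<Longrightarrow> e \<in> Q h \<inter> E \<Longrightarrow> \<tau> h \<in> Ch e"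
    and w: "\<And>h. h \<in> H \<Longrightarrow> w h \<ge> 0"
  shows "\<exists>c. (\<forall>e\<in>E. c e \<in> Ch e) \<and>
    (\<Sum>h\<in>H. w h * (1 - s) ^ card {e \<in> Q h \<inter> E. c e = \<tau> h}) \<le> (\<Sum>h\<in>H. w h * (1 - s / q) ^ card (Q h \<inter> E))"
  using assms(1) Ch Q w
proof (induction E arbitrary: w rule: finite_induct)
  case empty
  then show ?case by auto
next
  case (insert e E)
  have Che: "finite (Ch e)" "Ch e \<noteq> {}" "card (Ch e) \<le> q" using insert.prems(1)[of e] by auto
  then have c1: "card (Ch e) \<ge> 1" by (simp add: Suc_le_eq card_gt_0_iff)
  then have q1: "q \<ge> 1" using Che by linarith
  then have sq: "0 \<le> s / q" "s / q \<le> 1" "1 - s / q \<ge> 0" using assms(3,4) by (auto simp: divide_le_eq)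
  define v where "v x h = w h * (1 - s * of_bool (e \<in> Q h \<and> x = \<tau> h))" for x h
  define B where "B h = (1 - s / q) ^ card (Q h \<inter> E)" for h
  have B0: "B h \<ge> 0" for h unfolding B_def using sq by simp
  have avg: "(\<Sum>x\<in>Ch e. v x h) \<le> card (Ch e) * (w h * (1 - s / q * of_bool (e \<in> Q h)))" if h: "h \<in> H" for h
  proof (cases "e \<in> Q h")
    case True
    then have t: "\<tau> h \<in> Ch e" using insert.prems(2)[OF h] by auto
    have "(\<Sum>x\<in>Ch e. v x h) = w h * (\<Sum>x\<in>Ch e. 1 - s * of_bool (x = \<tau> h))"
      unfolding v_def using True by (simp add: sum_distrib_left)
    also have "(\<Sum>x\<in>Ch e. 1 - s * of_bool (x = \<tau> h)) = card (Ch e) - s"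
      using t Che(1) by (simp add: sum_subtractf sum_distrib_left[symmetric] of_bool_def sum.delta)
    also have "\<dots> \<le> card (Ch e) * (1 - s / q)"
      using mult_left_mono[OF Che(3) assms(3)] q1 by (simp add: field_simps)
    finally show ?thesis using True insert.prems(3)[OF h] by (simp add: mult_left_mono mult.left_commute)
  next
    case False
    then show ?thesis unfolding v_def by simp
  qed
  have "(\<Sum>x\<in>Ch e. \<Sum>h\<in>H. v x h * B h) = (\<Sum>h\<in>H. (\<Sum>x\<in>Ch e. v x h) * B h)"
    by (subst sum.swap) (simp add: sum_distrib_right)
  also have "\<dots> \<le> (\<Sum>h\<in>H. card (Ch e) * (w h * (1 - s / q * of_bool (e \<in> Q h))) * B h)"
    using avg B0 by (intro sum_mono mult_right_mono) auto
  also have "\<dots> = card (Ch e) * (\<Sum>h\<in>H. w h * (1 - s / q * of_bool (e \<in> Q h)) * B h)"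
    by (simp add: sum_distrib_left mult.assoc)
  finally obtain x where x: "x \<in> Ch e"
    "(\<Sum>h\<in>H. v x h * B h) \<le> (\<Sum>h\<in>H. w h * (1 - s / q * of_bool (e \<in> Q h)) * B h)"
    using exists_le_average[OF Che(1,2)] by blast
  have "\<exists>c. (\<forall>e\<in>E. c e \<in> Ch e) \<and>
    (\<Sum>h\<in>H. v x h * (1 - s) ^ card {e \<in> Q h \<inter> E. c e = \<tau> h}) \<le> (\<Sum>h\<in>H. v x h * (1 - s / q) ^ card (Q h \<inter> E))"
    by (rule insert.IH) (use insert.prems assms(3,4) in \<open>auto simp: v_def of_bool_def\<close>)
  then obtain c where c: "\<forall>e\<in>E. c e \<in> Ch e"
    "(\<Sum>h\<in>H. v x h * (1 - s) ^ card {e \<in> Q h \<inter> E. c e = \<tau> h}) \<le> (\<Sum>h\<in>H. v x h * B h)"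
    unfolding B_def by blast
  define c' where "c' = c(e := x)"
  have e1: "w h * (1 - s) ^ card {a \<in> Q h \<inter> insert e E. c' a = \<tau> h}
      = v x h * (1 - s) ^ card {e \<in> Q h \<inter> E. c e = \<tau> h}" for h
  proof -
    have "{a \<in> Q h \<inter> insert e E. c' a = \<tau> h} = (if e \<in> Q h \<and> x = \<tau> h
        then insert e {e \<in> Q h \<inter> E. c e = \<tau> h} else {e \<in> Q h \<inter> E. c e = \<tau> h})"
      using insert.hyps(2) unfolding c'_def by auto
    then show ?thesis using insert.hyps unfolding v_def by auto
  qed
  have e2: "(1 - s / q * of_bool (e \<in> Q h)) * B h = (1 - s / q) ^ card (Q h \<inter> insert e E)" for h
    using insert.hyps unfolding B_def by (auto simp: Int_insert_right)
  show ?case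
    by (rule exI[of _ c']) (use c x e1 e2 in \<open>auto simp: c'_def mult.assoc\<close>)
qed

section \<open>Random arrangements\<close>

text \<open>Extensional functions count each bijection once and form a finite set, whose fractions
  serve as probabilities.\<close>

definition arrangements :: "nat \<Rightarrow> 'a set \<Rightarrow> (nat \<Rightarrow> 'a) set" where
  "arrangements n V = {f \<in> {..<n} \<rightarrow>\<^sub>E V. bij_betw f {..<n} V}"

lemma finite_arrangements: "finite V \<Longrightarrow> finite (arrangements n V)"
  unfolding arrangements_def
  by (rule finite_subset[of _ "{..<n} \<rightarrow>\<^sub>E V"]) (auto intro: finite_PiE)

lemma arrangements_nonempty:
  assumes "finite V" "card V = n"
  shows "arrangements n V \<noteq> {}"
proof -
  obtain f where "bij_betw f {..<n} V" using assms ex_bij_betw_nat_finite[of V] by (auto simp: atLeast0LessThan)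
  then have "restrict f {..<n} \<in> arrangements n V"
    unfolding arrangements_def by (auto simp: bij_betw_def inj_on_def)
  then show ?thesis by auto
qed

lemma arrangements_transpose:
  assumes "f \<in> arrangements n V" "p < n" "p' < n"
  shows "f \<circ> transpose p p' \<in> arrangements n V"
proof -
  have "bij_betw (transpose p p') {..<n} {..<n}"
    using assms(2,3) by (intro bij_betw_byWitness[where f' = "transpose p p'"]) (auto simp: transpose_def)
  then have "bij_betw (f \<circ> transpose p p') {..<n} V"
    using assms(1) unfolding arrangements_def by (auto intro: bij_betw_trans)
  then show ?thesis
    using assms unfolding arrangements_def by (auto simp: PiE_def extensional_def transpose_def)
qed

text \<open>
  Conditioned on the vertices at the positions in \<open>R\<close>, the vertex at \<open>p\<close> is uniform among the
  remaining \<open>n - card R\<close> vertices.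
\<close>

lemma arrangements_conditional:
  fixes b :: real
  assumes V: "finite V" and G: "G \<subseteq> arrangements n V" and p: "p < n" "p \<notin> R" and R: "R \<subseteq> {..<n}"
    and inv: "\<And>f p'. f \<in> G \<Longrightarrow> p' < n \<Longrightarrow> p' \<notin> R \<Longrightarrow>
      f \<circ> transpose p p' \<in> G \<and> Bad (f \<circ> transpose p p') = Bad f"
    and b: "\<And>f. f \<in> G \<Longrightarrow> card {v \<in> V. v \<in> Bad f} \<le> b"
  shows "(real n - card R) * card {f \<in> G. f p \<in> Bad f} \<le> b * card G"
proof -
  have finG: "finite G" using G finite_arrangements[OF V] finite_subset by blast
  have finR: "finite R" using R finite_subset by blast
  \<comment> \<open>Swapping the contents of p and p' turns a bad vertex at p into a bad vertex at
    p'. Since p and p' avoid R, neither G nor \<open>Bad\<close> notices the swap; keeping p' as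
    second component makes the map injective.\<close>
  define P1 where "P1 = {f \<in> G. f p \<in> Bad f} \<times> ({..<n} - R)"
  define P2 where "P2 = (SIGMA g:G. {p'. p' < n \<and> g p' \<in> Bad g})"
  define \<Phi> where "\<Phi> = (\<lambda>(f, p'). (f \<circ> transpose p p' :: nat \<Rightarrow> 'a, p'))"
  have "inj_on \<Phi> P1"
  proof (rule inj_onI, clarsimp simp: \<Phi>_def)
    fix f g p' assume "f \<circ> transpose p p' = g \<circ> transpose p p'"
    then have "f \<circ> transpose p p' \<circ> transpose p p' = g \<circ> transpose p p' \<circ> transpose p p'" by simp
    then show "f = g" by (simp add: o_assoc[symmetric])
  qed
  moreover have "\<Phi> ` P1 \<subseteq> P2"
    unfolding \<Phi>_def P1_def P2_def using inv by auto
  moreover have "finite P2" unfolding P2_def using finG by auto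
  ultimately have "card P1 \<le> card P2" by (rule card_inj_on_le)
  moreover have "card P1 = card {f \<in> G. f p \<in> Bad f} * (n - card R)"
    unfolding P1_def using R finR by (simp add: card_cartesian_product card_Diff_subset)
  moreover have "real (card P2) \<le> b * card G"
  proof -
    have "real (card P2) = (\<Sum>g\<in>G. real (card {p'. p' < n \<and> g p' \<in> Bad g}))"
      unfolding P2_def using finG by (subst card_SigmaI) auto
    also have "\<dots> \<le> (\<Sum>g\<in>G. b)"
    proof (rule sum_mono)
      fix g assume g: "g \<in> G"
      then have bij: "bij_betw g {..<n} V" using G unfolding arrangements_def by auto
      have "card {p'. p' < n \<and> g p' \<in> Bad g} = card (g ` {p'. p' < n \<and> g p' \<in> Bad g})"
        by (rule card_image[symmetric]) (use bij in \<open>auto simp: bij_betw_def inj_on_def\<close>)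
      also have "\<dots> \<le> card {v \<in> V. v \<in> Bad g}"
        by (rule card_mono) (use V bij in \<open>auto simp: bij_betw_def\<close>)
      finally show "real (card {p'. p' < n \<and> g p' \<in> Bad g}) \<le> b" using b[OF g] by linarith
    qed
    finally show ?thesis by (simp add: mult.commute)
  qed
  moreover have "card R \<le> n" using R by (metis card_lessThan card_mono finite_lessThan)
  then have "(real n - card R) * card {f \<in> G. f p \<in> Bad f} = real (card {f \<in> G. f p \<in> Bad f} * (n - card R))"
    by (simp add: of_nat_diff)
  ultimately show ?thesis by (metis of_nat_mono order_trans)
qed

text \<open>The edges of J are exposed in increasing order. When i is reached, at most L positions
  are revealed, those of earlier edges and \<open>Q i - {p i}\<close>. The vertex at
  \<open>p i\<close> is then uniform among at least n - L vertices, of which at most b spoil the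
  edge. These conditional factors multiply.\<close>

lemma arrangements_chain:
  fixes Q :: "nat \<Rightarrow> nat set" and b :: real
  assumes V: "finite V" "card V = n" and k: "k \<ge> 1"
    and b: "\<And>A. A \<subseteq> V \<Longrightarrow> card A = k - 1 \<Longrightarrow> card {v \<in> V. insert v A \<notin> E} \<le> b" "b \<ge> 0"
    and J: "finite J" "k * card J \<le> L" and L: "L < n"
    and Q: "\<And>i. i \<in> J \<Longrightarrow> Q i \<subseteq> {..<n} \<and> card (Q i) = k \<and> p i \<in> Q i"
    and p: "\<And>i i'. i \<in> J \<Longrightarrow> i' \<in> J \<Longrightarrow> i' < i \<Longrightarrow> p i \<notin> Q i'"
  shows "card {f \<in> arrangements n V. \<forall>i\<in>J. f ` Q i \<notin> E}
    \<le> (b / (real n - L)) ^ card J * card (arrangements n V)"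
  using J Q p
proof (induction J rule: finite_linorder_max_induct)
  case empty
  then show ?case by simp
next
  case (insert i J)
  define G where "G = {f \<in> arrangements n V. \<forall>i\<in>J. f ` Q i \<notin> E}"
  define R where "R = (Q i - {p i}) \<union> \<Union>(Q ` J)"
  define Bad where "Bad f = {v. insert v (f ` (Q i - {p i})) \<notin> E}" for f :: "nat \<Rightarrow> 'a"
  have Qi: "Q i \<subseteq> {..<n}" "card (Q i) = k" "p i \<in> Q i" using insert.prems(2)[of i] by auto
  have finQ: "finite (Q i)" using Qi(1) finite_subset by blast
  have iJ: "i \<notin> J" using insert.hyps by auto
  have cJ: "k * card J \<le> L" and cJ': "k + k * card J \<le> L"
    using insert.prems(1) insert.hyps iJ by auto
  have IH: "real (card G) \<le> (b / (real n - L)) ^ card J * card (arrangements n V)"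
    unfolding G_def by (rule insert.IH) (use insert.prems cJ in auto)
  have cR: "card R \<le> L"
  proof -
    have "card (\<Union>(Q ` J)) \<le> (\<Sum>i\<in>J. card (Q i))" using insert.hyps(1) by (rule card_UN_le)
    also have "\<dots> = k * card J" using insert.prems(2) by (simp add: mult.commute)
    finally have "card R \<le> (k - 1) + k * card J"
      unfolding R_def using card_Un_le[of "Q i - {p i}" "\<Union>(Q ` J)"] Qi finQ
      by (simp add: card_Diff_singleton)
    then show ?thesis using cJ' k by linarith
  qed
  have cond: "(real n - card R) * card {f \<in> G. f (p i) \<in> Bad f} \<le> b * card G"
  proof (rule arrangements_conditional[OF V(1)])
    show "G \<subseteq> arrangements n V" unfolding G_def by auto
    show "p i < n" using Qi by auto
    show "p i \<notin> R" unfolding R_def using insert.prems(3)[of i] insert.hyps by auto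
    show "R \<subseteq> {..<n}" unfolding R_def using insert.prems(2) by auto
    fix f p' assume f: "f \<in> G" and p': "p' < n" "p' \<notin> R"
    have img: "(f \<circ> transpose (p i) p') ` S = f ` S" if "S \<subseteq> R" for S
    proof (rule image_cong[OF refl])
      fix x assume "x \<in> S"
      then have "x \<noteq> p i" "x \<noteq> p'" using that p' \<open>p i \<notin> R\<close> by auto
      then show "(f \<circ> transpose (p i) p') x = f x" by simp
    qed
    have "(f \<circ> transpose (p i) p') ` Q i' = f ` Q i'" if "i' \<in> J" for i'
      by (rule img) (use that in \<open>auto simp: R_def\<close>)
    moreover have "(f \<circ> transpose (p i) p') ` (Q i - {p i}) = f ` (Q i - {p i})"
      by (rule img) (auto simp: R_def)
    moreover have "f \<circ> transpose (p i) p' \<in> arrangements n V"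
      using f p' \<open>p i < n\<close> unfolding G_def by (auto intro: arrangements_transpose)
    ultimately show "f \<circ> transpose (p i) p' \<in> G \<and> Bad (f \<circ> transpose (p i) p') = Bad f"
      using f unfolding G_def Bad_def by auto
  next
    fix f assume f: "f \<in> G"
    then have bij: "bij_betw f {..<n} V" unfolding G_def arrangements_def by auto
    have "f ` (Q i - {p i}) \<subseteq> V" using Qi(1) bij by (auto simp: bij_betw_def)
    moreover have "card (f ` (Q i - {p i})) = k - 1"
      using Qi bij finQ by (subst card_image) (auto simp: bij_betw_def inj_on_def card_Diff_singleton)
    ultimately show "card {v \<in> V. v \<in> Bad f} \<le> b" unfolding Bad_def using b(1) by auto
  qed
  have "f (p i) \<in> Bad f \<longleftrightarrow> f ` Q i \<notin> E" for f
  proof -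
    have "insert (f (p i)) (f ` (Q i - {p i})) = f ` Q i" using Qi(3) by auto
    then show ?thesis unfolding Bad_def by simp
  qed
  then have set_eq: "{f \<in> arrangements n V. \<forall>i\<in>insert i J. f ` Q i \<notin> E} = {f \<in> G. f (p i) \<in> Bad f}"
    unfolding G_def by auto
  have "(real n - L) * card {f \<in> G. f (p i) \<in> Bad f} \<le> (real n - card R) * card {f \<in> G. f (p i) \<in> Bad f}"
    using cR by (intro mult_right_mono) auto
  then have "(real n - L) * card {f \<in> G. f (p i) \<in> Bad f} \<le> b * card G" using cond by linarith
  then have "card {f \<in> G. f (p i) \<in> Bad f} \<le> b / (real n - L) * card G"
    using L by (simp add: field_simps)
  also have "\<dots> \<le> b / (real n - L) * ((b / (real n - L)) ^ card J * card (arrangements n V))"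
    using IH L b(2) by (intro mult_left_mono) auto
  finally show ?case unfolding set_eq using iJ insert.hyps(1) by (simp add: mult.assoc)
qed

section \<open>Tail bounds through binomial moments\<close>

lemma binomial_ratio:
  fixes u z j :: nat
  assumes "j < z"
  shows "(real z - j) ^ j * (u choose j) \<le> real u ^ j * (z choose j)"
proof -
  have "fact j * real (u choose j) \<le> real u ^ j"
    using of_nat_mono[OF binomial_fact_pow[of u j], where 'a = real] by (simp add: mult.commute)
  moreover have "(real z - j) ^ j \<le> fact j * (z choose j)"
  proof -
    have "(real z - j) ^ j = (\<Prod>i = 0..<j. real z - j)" by simp
    also have "\<dots> \<le> (\<Prod>i = 0..<j. real z - i)" using assms by (intro prod_mono) auto
    also have "\<dots> = fact j * (real z gchoose j)" by (simp add: gbinomial_prod_rev)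
    finally show ?thesis by (simp add: binomial_gbinomial)
  qed
  ultimately have "((real z - j) ^ j) * (fact j * real (u choose j)) \<le> (fact j * (z choose j)) * real u ^ j"
    using assms by (intro mult_mono) auto
  then have "fact j * ((real z - j) ^ j * real (u choose j)) \<le> fact j * (real u ^ j * (z choose j))"
    by (simp add: mult_ac)
  then show ?thesis by simp
qed

lemma sum_card_swap:
  assumes "finite A" "finite B"
  shows "(\<Sum>a\<in>A. card {b \<in> B. P a b}) = (\<Sum>b\<in>B. card {a \<in> A. P a b})"
proof -
  have "(\<Sum>a\<in>A. \<Sum>b\<in>B. of_bool (P a b) :: nat) = (\<Sum>b\<in>B. \<Sum>a\<in>A. of_bool (P a b))"
    by (rule sum.swap)
  then show ?thesis using assms by (simp add: of_bool_def sum.If_cases Int_def)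
qed

text \<open>This is Markov's inequality for the binomial moment of order j. With at least z missing
  edges there are at least z choose j sets of j missing edges, and each j-set is missing entirely
  with the small probability of \<open>arrangements_chain\<close>. Exposing only j edges instead of
  z keeps the number k * j of revealed positions below n.\<close>

lemma arrangements_tail:
  fixes Q :: "nat \<Rightarrow> nat set" and b :: real
  assumes V: "finite V" "card V = n" and k: "k \<ge> 1"
    and b: "\<And>A. A \<subseteq> V \<Longrightarrow> card A = k - 1 \<Longrightarrow> card {v \<in> V. insert v A \<notin> E} \<le> b" "b \<ge> 0"
    and U: "finite U" and j: "k * j < n" "j < z"
    and Q: "\<And>i. i \<in> U \<Longrightarrow> Q i \<subseteq> {..<n} \<and> card (Q i) = k \<and> p i \<in> Q i"
    and p: "\<And>i i'. i \<in> U \<Longrightarrow> i' \<in> U \<Longrightarrow> i' < i \<Longrightarrow> p i \<notin> Q i'"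
  shows "card {f \<in> arrangements n V. z \<le> card {i \<in> U. f ` Q i \<notin> E}}
    \<le> (b / (real n - k * j) * (card U / (real z - j))) ^ j * card (arrangements n V)"
proof -
  let ?\<Omega> = "arrangements n V"
  define \<beta> where "\<beta> = b / (real n - k * j)"
  have fin: "finite ?\<Omega>" by (rule finite_arrangements[OF V(1)])
  define X where "X = {f \<in> ?\<Omega>. z \<le> card {i \<in> U. f ` Q i \<notin> E}}"
  define S where "S = {J. J \<subseteq> U \<and> card J = j}"
  have finS: "finite S" unfolding S_def using U by auto
  have cS: "card S = (card U choose j)" unfolding S_def by (rule n_subsets[OF U])
  have "real (card X * (z choose j)) \<le> real (\<Sum>f\<in>X. card {J \<in> S. \<forall>i\<in>J. f ` Q i \<notin> E})"
  proof -
    have "card X * (z choose j) = (\<Sum>f\<in>X. z choose j)" by simp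
    also have "\<dots> \<le> (\<Sum>f\<in>X. card {J \<in> S. \<forall>i\<in>J. f ` Q i \<notin> E})"
    proof (rule sum_mono)
      fix f assume f: "f \<in> X"
      have "{J \<in> S. \<forall>i\<in>J. f ` Q i \<notin> E} = {J. J \<subseteq> {i \<in> U. f ` Q i \<notin> E} \<and> card J = j}"
        unfolding S_def by auto
      then have "card {J \<in> S. \<forall>i\<in>J. f ` Q i \<notin> E} = (card {i \<in> U. f ` Q i \<notin> E} choose j)"
        using n_subsets[of "{i \<in> U. f ` Q i \<notin> E}"] U by simp
      then show "(z choose j) \<le> card {J \<in> S. \<forall>i\<in>J. f ` Q i \<notin> E}"
        using f unfolding X_def by (simp add: binomial_right_mono)
    qed
    finally show ?thesis by (rule of_nat_mono)
  qed
  also have "(\<Sum>f\<in>X. card {J \<in> S. \<forall>i\<in>J. f ` Q i \<notin> E})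
      \<le> (\<Sum>f\<in>?\<Omega>. card {J \<in> S. \<forall>i\<in>J. f ` Q i \<notin> E})"
    using fin by (intro sum_mono2) (auto simp: X_def)
  also have "\<dots> = (\<Sum>J\<in>S. card {f \<in> ?\<Omega>. \<forall>i\<in>J. f ` Q i \<notin> E})"
    by (rule sum_card_swap[OF fin finS])
  also have "real \<dots> \<le> (\<Sum>J\<in>S. \<beta> ^ j * card ?\<Omega>)"
    unfolding of_nat_sum
  proof (rule sum_mono)
    fix J assume "J \<in> S"
    then have J: "J \<subseteq> U" "card J = j" unfolding S_def by auto
    have "card {f \<in> ?\<Omega>. \<forall>i\<in>J. f ` Q i \<notin> E} \<le> (b / (real n - real (k * j))) ^ card J * card ?\<Omega>"
    proof (rule arrangements_chain[OF V k b])
      show "finite J" "k * card J \<le> k * j" "k * j < n" using J finite_subset[OF _ U] j by auto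
      show "Q i \<subseteq> {..<n} \<and> card (Q i) = k \<and> p i \<in> Q i" if "i \<in> J" for i using J that by (intro Q) auto
      show "p i \<notin> Q i'" if "i \<in> J" "i' \<in> J" "i' < i" for i i' using J that by (intro p) auto
    qed
    then show "real (card {f \<in> ?\<Omega>. \<forall>i\<in>J. f ` Q i \<notin> E}) \<le> \<beta> ^ j * card ?\<Omega>"
      using J unfolding \<beta>_def by simp
  qed
  also have "\<dots> = (card U choose j) * (\<beta> ^ j * card ?\<Omega>)" by (simp add: cS)
  finally have main: "real (card X) * (z choose j) \<le> (card U choose j) * (\<beta> ^ j * card ?\<Omega>)" by simp
  have z: "real (z choose j) > 0" "real z - j > 0" using j by (auto simp: zero_less_binomial_iff)
  have kj: "real n - k * j > 0" using j(1) by (metis diff_gt_0_iff_gt of_nat_less_iff of_nat_mult)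
  then have \<beta>0: "\<beta> \<ge> 0" unfolding \<beta>_def using b(2) by simp
  have "(real z - j) ^ j * (real (card X) * (z choose j)) \<le> (real z - j) ^ j * ((card U choose j) * (\<beta> ^ j * card ?\<Omega>))"
    using main z by (intro mult_left_mono) auto
  also have "\<dots> = ((real z - j) ^ j * (card U choose j)) * (\<beta> ^ j * card ?\<Omega>)" by simp
  also have "\<dots> \<le> (real (card U) ^ j * (z choose j)) * (\<beta> ^ j * card ?\<Omega>)"
    using binomial_ratio[OF j(2)] \<beta>0 by (intro mult_right_mono) auto
  finally have "(z choose j) * ((real z - j) ^ j * real (card X)) \<le> (z choose j) * (real (card U) ^ j * (\<beta> ^ j * card ?\<Omega>))"
    by (simp add: mult_ac)
  then have "(real z - j) ^ j * real (card X) \<le> real (card U) ^ j * (\<beta> ^ j * card ?\<Omega>)" using z by simp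
  then have "real (card X) \<le> (\<beta> * (card U / (real z - j))) ^ j * card ?\<Omega>"
    using z by (simp add: field_simps power_mult_distrib power_divide)
  then show ?thesis unfolding X_def \<beta>_def by simp
qed

text \<open>Relabelling V by a permutation that carries e to e' embeds the arrangements with image e
  into those with image e'. The fibres over the different k-sets are disjoint and none is smaller
  than the one over e.\<close>

lemma card_arrangements_image_le:
  assumes V: "finite V" "card V = n" and Q: "Q \<subseteq> {..<n}" "card Q = k" and e: "e \<subseteq> V" "card e = k"
  shows "(n choose k) * card {f \<in> arrangements n V. f ` Q = e} \<le> card (arrangements n V)"
proof -
  let ?F = "\<lambda>e. {f \<in> arrangements n V. f ` Q = e}"
  define S where "S = {e. e \<subseteq> V \<and> card e = k}"
  have fin: "finite (arrangements n V)" by (rule finite_arrangements[OF V(1)])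
  have le: "card (?F e) \<le> card (?F e')" if e': "e' \<in> S" for e'
  proof -
    have fe: "finite e" "finite e'" using e e' V(1) finite_subset unfolding S_def by auto
    obtain g1 where g1: "bij_betw g1 e e'"
      using finite_same_card_bij[OF fe] e e' S_def by auto
    have "card (V - e) = card (V - e')" using e e' fe unfolding S_def by (simp add: card_Diff_subset)
    then obtain g2 where g2: "bij_betw g2 (V - e) (V - e')"
      using finite_same_card_bij[of "V - e" "V - e'"] V(1) by auto
    define g where "g x = (if x \<in> e then g1 x else g2 x)" for x
    have "bij_betw g e e'" using g1 by (rule bij_betw_cong[THEN iffD1, rotated]) (simp add: g_def)
    moreover have "bij_betw g (V - e) (V - e')"
      using g2 by (rule bij_betw_cong[THEN iffD1, rotated]) (simp add: g_def)
    ultimately have "bij_betw g (e \<union> (V - e)) (e' \<union> (V - e'))" by (rule bij_betw_combine) auto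
    moreover have "e \<union> (V - e) = V" "e' \<union> (V - e') = V" using e e' S_def by auto
    ultimately have g: "bij_betw g V V" and ge: "g ` e = e'"
      using \<open>bij_betw g e e'\<close> by (auto simp: bij_betw_def)
    define \<Phi> where "\<Phi> f = restrict (g \<circ> f) {..<n}" for f
    have "inj_on \<Phi> (?F e)"
    proof (rule inj_onI)
      fix f f' assume f: "f \<in> ?F e" "f' \<in> ?F e" and eq: "\<Phi> f = \<Phi> f'"
      have mem: "f \<in> {..<n} \<rightarrow>\<^sub>E V" "f' \<in> {..<n} \<rightarrow>\<^sub>E V" using f unfolding arrangements_def by auto
      show "f = f'"
      proof (rule PiE_ext[OF mem])
        fix x assume x: "x \<in> {..<n}"
        then have "g (f x) = g (f' x)" using fun_cong[OF eq, of x] unfolding \<Phi>_def by simp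
        then show "f x = f' x"
          using g mem x by (meson PiE_mem bij_betw_imp_inj_on inj_onD)
      qed
    qed
    moreover have "\<Phi> ` ?F e \<subseteq> ?F e'"
    proof (clarsimp, intro conjI)
      fix f assume f: "f \<in> arrangements n V" "e = f ` Q"
      then have "bij_betw f {..<n} V" unfolding arrangements_def by auto
      then have "bij_betw (g \<circ> f) {..<n} V" using g by (rule bij_betw_trans)
      then have "bij_betw (\<Phi> f) {..<n} V"
        by (rule bij_betw_cong[THEN iffD1, rotated]) (simp add: \<Phi>_def)
      then show "\<Phi> f \<in> arrangements n V"
        unfolding arrangements_def \<Phi>_def by (auto simp: bij_betw_def)
      have "\<Phi> f ` Q = g ` f ` Q" using Q(1) unfolding \<Phi>_def by (auto simp: image_iff)
      then show "\<Phi> f ` Q = e'" using ge f by simp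
    qed
    ultimately show ?thesis using fin by (intro card_inj_on_le) auto
  qed
  have finS: "finite S" unfolding S_def using V(1) by auto
  have "(n choose k) * card (?F e) = (\<Sum>e'\<in>S. card (?F e))"
    using n_subsets[OF V(1), of k] V(2) unfolding S_def by simp
  also have "\<dots> \<le> (\<Sum>e'\<in>S. card (?F e'))" using le by (rule sum_mono)
  also have "\<dots> = card (\<Union>e'\<in>S. ?F e')"
    by (rule card_UN_disjoint[symmetric]) (use fin finS in auto)
  also have "\<dots> \<le> card (arrangements n V)" by (rule card_mono) (use fin in auto)
  finally show ?thesis .
qed

section \<open>Templates\<close>

text \<open>
  Positions \<open>{..<d * m}\<close> split into \<open>m\<close> blocks of length \<open>d\<close>. The last position of each block is
  movable: an edge consists of the fixed positions of block \<open>i\<close>, the first \<open>l\<close> positions of the next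
  block, and the movable position of some block \<open>y\<close>. A bijection \<open>i \<mapsto> y\<close> then yields a Hamilton cycle.
\<close>

definition base_positions :: "nat \<Rightarrow> nat \<Rightarrow> nat \<Rightarrow> nat \<Rightarrow> nat set" where
  "base_positions d l m i =
     {x. x div d = i \<and> x mod d < d - 1 \<or> x div d = Suc i mod m \<and> x mod d < l}"

definition movable :: "nat \<Rightarrow> nat \<Rightarrow> nat" where
  "movable d y = d - 1 + y * d"

definition edge_positions :: "nat \<Rightarrow> nat \<Rightarrow> nat \<Rightarrow> nat \<Rightarrow> nat \<Rightarrow> nat set" where
  "edge_positions d l m i y = insert (movable d y) (base_positions d l m i)"

lemma block_prefix:
  fixes d :: nat
  assumes "d > 0" "c \<le> d"
  shows "{x. x div d = i \<and> x mod d < c} = {i * d..<i * d + c}"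
proof (intro set_eqI iffI)
  fix x assume "x \<in> {x. x div d = i \<and> x mod d < c}"
  then show "x \<in> {i * d..<i * d + c}" using div_mult_mod_eq[of x d] by auto
next
  fix x assume x: "x \<in> {i * d..<i * d + c}"
  then obtain r where r: "x = r + i * d" "r < c" by (metis add.commute atLeastLessThan_iff le_Suc_ex nat_add_left_cancel_less)
  then show "x \<in> {x. x div d = i \<and> x mod d < c}" using assms by simp
qed

lemma block_div_mod:
  fixes d :: nat
  assumes "c < d"
  shows "(i * d + c) div d = i" "(i * d + c) mod d = c"
  using assms by auto

lemma movable_div_mod [simp]:
  assumes "d > 0"
  shows "movable d y div d = y" "movable d y mod d = d - 1"
  using assms block_div_mod[of "d - 1" d y] unfolding movable_def by (simp_all add: add.commute)

text \<open>With at least three blocks, a block and its next two successors are pairwise distinct.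
  For m = 2 two edges could meet at both ends.\<close>

lemma succ_mod:
  fixes i m :: nat
  assumes "m \<ge> 3" "i < m"
  shows "Suc i mod m < m" "Suc i mod m \<noteq> i" "Suc (Suc i mod m) mod m \<noteq> i"
    "Suc (Suc i mod m) mod m \<noteq> Suc i mod m"
  using assms by (auto simp: mod_Suc)

context
  fixes d l m :: nat
  assumes d: "d \<ge> 2" and l: "l \<le> d - 1" and m: "m \<ge> 3"
begin

lemma div_less_iff: "x div d < m \<longleftrightarrow> x < d * m"
  using d by (metis div_less_iff_less_mult mult.commute less_le_trans zero_less_numeral)

lemma edge_positions_subset:
  assumes "i < m" "y < m"
  shows "edge_positions d l m i y \<subseteq> {..<d * m}"
  using assms m d succ_mod(1)[OF m assms(1)]
  unfolding edge_positions_def base_positions_def by (auto simp flip: div_less_iff)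

lemma card_edge_positions:
  assumes "i < m" "y < m"
  shows "card (edge_positions d l m i y) = d + l"
proof -
  let ?A = "{x. x div d = i \<and> x mod d < d - 1}" and ?B = "{x. x div d = Suc i mod m \<and> x mod d < l}"
  have "card ?A = d - 1" "finite ?A" "card ?B = l" "finite ?B"
    using d l by (simp_all add: block_prefix)
  moreover have "base_positions d l m i = ?A \<union> ?B" unfolding base_positions_def by auto
  moreover have "?A \<inter> ?B = {}" using succ_mod(2)[OF m assms(1)] by auto
  ultimately have "card (base_positions d l m i) = d - 1 + l" "finite (base_positions d l m i)"
    by (simp_all add: card_Un_disjoint)
  moreover have "movable d y \<notin> base_positions d l m i"
    using d l unfolding base_positions_def by auto
  ultimately show ?thesis unfolding edge_positions_def using d by simp
qed

lemma movable_in_edge_positions_iff: "movable d y \<in> edge_positions d l m i y' \<longleftrightarrow> y = y'"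
proof -
  have "movable d y = movable d y' \<longleftrightarrow> y = y'"
  proof
    assume "movable d y = movable d y'"
    then have "movable d y div d = movable d y' div d" by (rule arg_cong)
    then show "y = y'" using d by simp
  qed simp
  then show ?thesis using d l unfolding edge_positions_def base_positions_def by auto
qed

lemma edge_positions_inject:
  assumes eq: "edge_positions d l m i y = edge_positions d l m i' y'" and i: "i < m" "i' < m"
  shows "i = i' \<and> y = y'"
proof -
  have y: "y = y'" using movable_in_edge_positions_iff[of y i y] movable_in_edge_positions_iff[of y i' y'] eq by auto
  \<comment> \<open>A row is recognised by the first position of its block, which is fixed because d
    \<ge> 2 and can occur only in this row and the preceding one. Two different rows with the same
    edge would each follow the other cyclically, which m \<ge> 3 excludes.\<close>
  have start: "j = j' \<or> j = Suc j' mod m" if "j * d \<in> edge_positions d l m j' y'" for j j' y'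
  proof -
    have "j * d \<noteq> movable d y'"
    proof
      assume eq: "j * d = movable d y'"
      have "movable d y' mod d = 0" unfolding eq[symmetric] by simp
      then show False using movable_div_mod(2)[of d y'] d by simp
    qed
    then show ?thesis using that d unfolding edge_positions_def base_positions_def by auto
  qed
  have own: "j * d \<in> edge_positions d l m j y" for j y
    using d unfolding edge_positions_def base_positions_def by auto
  have "i = i' \<or> i = Suc i' mod m" "i' = i \<or> i' = Suc i mod m"
    using start own eq by metis+
  then show ?thesis using y succ_mod(3)[OF m i(1)] by auto
qed

text \<open>
  The last fixed position of edge \<open>i\<close> in linear order: it is not used by the earlier edges. The
  edge \<open>m - 1\<close>, which wraps around, has no such position.
\<close>

definition pivot :: "nat \<Rightarrow> nat" where
  "pivot i = (if l = 0 then i * d + (d - 2) else Suc i * d + (l - 1))"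

lemma pivot_in:
  assumes "Suc i < m"
  shows "pivot i \<in> edge_positions d l m i y"
proof (cases "l = 0")
  case True
  have "d - 2 < d - 1" using d by linarith
  with block_div_mod[of "d - 2" d i] show ?thesis using True d unfolding pivot_def edge_positions_def base_positions_def by simp
next
  case False
  note block_div_mod[of "l - 1" d "Suc i"]
  then have "pivot i div d = Suc i" "pivot i mod d = l - 1" using False d l unfolding pivot_def by auto
  then show ?thesis using False assms unfolding edge_positions_def base_positions_def by simp
qed

lemma pivot_notin:
  assumes "i' < i" "Suc i < m"
  shows "pivot i \<notin> edge_positions d l m i' y"
proof (cases "l = 0")
  case True
  note block_div_mod[of "d - 2" d i]
  then have "pivot i div d = i" "pivot i mod d = d - 2" using True d unfolding pivot_def by auto
  then show ?thesis using True d assms movable_div_mod[of d y] unfolding edge_positions_def base_positions_def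
    by auto
next
  case False
  note block_div_mod[of "l - 1" d "Suc i"]
  then have "pivot i div d = Suc i" "pivot i mod d = l - 1" using False d l unfolding pivot_def by auto
  then show ?thesis using False d l assms movable_div_mod[of d y] unfolding edge_positions_def base_positions_def
    by (auto simp: mod_Suc)
qed

text \<open>The cyclic order is \<open>g\<close>: it ends block i with the vertex that
  \<open>f\<close> puts at the end of block \<open>\<sigma> i\<close> and agrees with
  \<open>f\<close> elsewhere. In this order the edge of row i becomes the window of d + l
  consecutive positions starting at i * d.\<close>

lemma hamilton_cycle_of_matching:
  assumes E: "uniform_hypergraph (d + l) V E" and f: "f \<in> arrangements (d * m) V"
    and \<sigma>: "bij_betw \<sigma> {..<m} {..<m}"
    and C: "\<And>i. i < m \<Longrightarrow> f ` edge_positions d l m i (\<sigma> i) \<in> E"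
  shows "hamilton_cycle (d + l) l V E ((\<lambda>i. f ` edge_positions d l m i (\<sigma> i)) ` {..<m})"
proof -
  define n where "n = d * m"
  define h where "h x = (if x mod d = d - 1 then movable d (\<sigma> (x div d)) else x)" for x
  define g where "g = f \<circ> h"
  have d0: "d > 0" using d by simp
  have fb: "bij_betw f {..<n} V" using f unfolding arrangements_def n_def by auto
  have \<sigma>m: "\<sigma> i < m" if "i < m" for i using \<sigma> that by (auto simp: bij_betw_def)
  have hmod: "h x mod d = x mod d" for x using d0 unfolding h_def by auto
  have hdiv: "h x div d = (if x mod d = d - 1 then \<sigma> (x div d) else x div d)" for x
    using d0 unfolding h_def by auto
  have hn: "h x < n" if "x < n" for x
    using that hdiv[of x] \<sigma>m unfolding n_def div_less_iff[symmetric] by auto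
  have hinj: "inj_on h {..<n}"
  proof (rule inj_onI)
    fix x y assume x: "x \<in> {..<n}" "y \<in> {..<n}" and eq: "h x = h y"
    have md: "x mod d = y mod d" using eq hmod by metis
    have "x div d < m" "y div d < m" using x unfolding n_def by (auto simp: div_less_iff)
    moreover have "x mod d = d - 1 \<and> \<sigma> (x div d) = \<sigma> (y div d) \<or> x div d = y div d"
      using hdiv[of x] hdiv[of y] eq md by (simp split: if_splits)
    ultimately have "x div d = y div d"
      using bij_betw_imp_inj_on[OF \<sigma>] by (auto dest: inj_onD)
    then show "x = y" using md by (metis div_mult_mod_eq)
  qed
  have "h ` {..<n} = {..<n}" using hn by (intro endo_inj_surj[OF _ _ hinj]) auto
  then have gb: "bij_betw g {..<n} V"
    unfolding g_def using fb hinj by (intro bij_betw_trans[of h]) (auto simp: bij_betw_def)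
  define wnd where "wnd i = {x. x div d = i \<or> x div d = Suc i mod m \<and> x mod d < l}" for i
  have wndn: "wnd i \<subseteq> {..<n}" if "i < m" for i
    using that m unfolding wnd_def n_def by (auto simp flip: div_less_iff)
  have hwnd: "h ` wnd i = edge_positions d l m i (\<sigma> i)" if i: "i < m" for i
  proof (intro equalityI subsetI)
    fix x assume "x \<in> h ` wnd i"
    then obtain x' where x': "x' \<in> wnd i" "x = h x'" by auto
    show "x \<in> edge_positions d l m i (\<sigma> i)"
    proof (cases "x' mod d = d - 1")
      case True
      then have "x' div d = i" using x' l unfolding wnd_def by auto
      then show ?thesis using True x' unfolding h_def edge_positions_def by auto
    next
      case False
      moreover have "x' mod d < d" using d0 by simp
      ultimately have "x' mod d < d - 1" by linarith
      then show ?thesis using False x' unfolding h_def edge_positions_def base_positions_def wnd_def by auto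
    qed
  next
    fix x assume x: "x \<in> edge_positions d l m i (\<sigma> i)"
    show "x \<in> h ` wnd i"
    proof (cases "x = movable d (\<sigma> i)")
      case True
      then have "x = h (movable d i)" using d0 unfolding h_def by auto
      moreover have "movable d i \<in> wnd i" using d0 unfolding wnd_def by auto
      ultimately show ?thesis by blast
    next
      case False
      then have "x \<in> base_positions d l m i" using x unfolding edge_positions_def by auto
      then have "x mod d < d - 1" "x \<in> wnd i" using l unfolding base_positions_def wnd_def by auto
      then have "x = h x" unfolding h_def by auto
      then show ?thesis using \<open>x \<in> wnd i\<close> by blast
    qed
  qed
  define vs where "vs = map g [0..<n]"
  have lvs: "length vs = n" unfolding vs_def by simp
  have n0: "n > 0" using d m unfolding n_def by auto
  have window: "{(i * d + j) mod n | j. j < d + l} = wnd i" if i: "i < m" for i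
  proof -
    have small: "(i * d + j) mod n = i * d + j" if "j < d" for j
    proof -
      have "(i * d + j) div d = i" using that by (rule block_div_mod)
      then have "i * d + j < n" using i unfolding n_def div_less_iff[symmetric] by simp
      then show ?thesis by simp
    qed
    have large: "(i * d + (d + j)) mod n = Suc i mod m * d + j" if "j < d" for j
    proof (cases "Suc i = m")
      case True
      then have "i * d + (d + j) = j + n" unfolding n_def True[symmetric] by simp
      then have "(i * d + (d + j)) mod n = (j + n) mod n" by (rule arg_cong)
      moreover have "j < n" using that m unfolding n_def by (simp add: div_less_iff[symmetric])
      ultimately show ?thesis using True by simp
    next
      case False
      then have "Suc i < m" using i by simp
      moreover have "(Suc i * d + j) div d = Suc i" using that by (rule block_div_mod)
      ultimately have "Suc i * d + j < n" unfolding n_def div_less_iff[symmetric] by simp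
      moreover have "i * d + (d + j) = Suc i * d + j" by simp
      ultimately show ?thesis using \<open>Suc i < m\<close> by (metis mod_less)
    qed
    show ?thesis
    proof (intro equalityI subsetI)
      fix x assume "x \<in> {(i * d + j) mod n | j. j < d + l}"
      then obtain j where j: "j < d + l" "x = (i * d + j) mod n" by auto
      show "x \<in> wnd i"
      proof (cases "j < d")
        case True
        then show ?thesis using small j unfolding wnd_def by simp
      next
        case False
        then obtain j' where j': "j = d + j'" using le_Suc_ex not_less by blast
        then have "j' < l" "j' < d" using j l d by auto
        then show ?thesis using large[of j'] j j' unfolding wnd_def by simp
      qed
    next
      fix x assume x: "x \<in> wnd i"
      have xd: "x mod d < d" using d0 by simp
      show "x \<in> {(i * d + j) mod n | j. j < d + l}"
      proof (cases "x div d = i")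
        case True
        then have "x = (i * d + x mod d) mod n" using small[OF xd] div_mult_mod_eq[of x d] by simp
        then show ?thesis using xd by (auto intro!: exI[of _ "x mod d"])
      next
        case False
        then have xx: "x div d = Suc i mod m" "x mod d < l" using x unfolding wnd_def by auto
        have "x = Suc i mod m * d + x mod d" using div_mult_mod_eq[of x d] unfolding xx(1) by (rule sym)
        then have "x = (i * d + (d + x mod d)) mod n" using large[OF xd] by simp
        then show ?thesis using xx(2) by (auto intro!: exI[of _ "d + x mod d"])
      qed
    qed
  qed
  have seg: "segment vs (d + l) (i * d) = g ` wnd i" if "i < m" for i
  proof -
    have "segment vs (d + l) (i * d) = g ` {(i * d + j) mod n | j. j < d + l}"
      unfolding segment_def lvs using n0 unfolding vs_def by (auto simp: image_iff)
    then show ?thesis using window[OF that] by simp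
  qed
  have edge: "f ` edge_positions d l m i (\<sigma> i) = g ` wnd i" if "i < m" for i
    by (simp only: g_def image_comp[symmetric] hwnd[OF that])
  define C' where "C' = (\<lambda>i. f ` edge_positions d l m i (\<sigma> i)) ` {..<m}"
  have sub: "C' \<subseteq> E" using C unfolding C'_def by auto
  have un: "uniform_hypergraph (d + l) V C'"
    using E sub unfolding uniform_hypergraph_def by auto
  have UnV: "\<Union>C' = V"
  proof
    show "\<Union>C' \<subseteq> V" using un unfolding uniform_hypergraph_def by auto
    show "V \<subseteq> \<Union>C'"
    proof
      fix v assume "v \<in> V"
      then obtain x where x: "x < n" "v = g x" using gb unfolding bij_betw_def by auto
      then have "x div d < m" unfolding n_def by (simp add: div_less_iff)
      moreover have "x \<in> wnd (x div d)" unfolding wnd_def by simp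
      ultimately show "v \<in> \<Union>C'" unfolding C'_def using edge x by auto
    qed
  qed
  define ss where "ss = map (\<lambda>i. i * d) [0..<m]"
  have lss: "length ss = m" unfolding ss_def by simp
  have nss: "ss ! i = i * d" if "i < m" for i using that unfolding ss_def by simp
  have "kl_cycle (d + l) l V C'"
    unfolding kl_cycle_def
  proof (intro conjI exI)
    show "uniform_hypergraph (d + l) V C'" "\<Union>C' = V" by fact+
    show "distinct vs" unfolding vs_def using gb by (simp add: distinct_map bij_betw_def atLeast0LessThan)
    show "set vs = V" unfolding vs_def using gb by (simp add: bij_betw_def atLeast0LessThan)
    show "sorted_wrt (<) ss" unfolding ss_def sorted_wrt_iff_nth_less using d0 by simp
    show "set ss \<subseteq> {..<length vs}"
    proof
      fix x assume "x \<in> set ss"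
      then obtain i where "i < m" "x = i * d" unfolding ss_def by auto
      then have "x div d < m" using d0 by simp
      then show "x \<in> {..<length vs}" unfolding lvs n_def by (simp add: div_less_iff)
    qed
    show "C' = segment vs (d + l) ` set ss"
      unfolding C'_def ss_def using seg edge by (auto simp: image_iff atLeast0LessThan)
    show "\<forall>i<length ss. \<forall>j<length ss. j = Suc i mod length ss \<and> i \<noteq> j \<longrightarrow>
           card (segment vs (d + l) (ss ! i) \<inter> segment vs (d + l) (ss ! j)) = l"
    proof (intro allI impI)
      fix i j assume ij: "i < length ss" "j < length ss" "j = Suc i mod length ss \<and> i \<noteq> j"
      then have i: "i < m" and j: "j < m" "j = Suc i mod m" using lss by auto
      note sm = succ_mod[OF m i]
      have inj: "inj_on g {..<n}" using gb unfolding bij_betw_def by auto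
      have "segment vs (d + l) (ss ! i) \<inter> segment vs (d + l) (ss ! j) = g ` (wnd i \<inter> wnd j)"
        using seg nss i j(1) inj_on_image_Int[OF inj wndn[OF i] wndn[OF j(1)]] by simp
      \<comment> \<open>Window i reaches only the first l positions of block j, and the block after
        j is neither i nor j, so the windows do not meet again on the other side.\<close>
      also have "wnd i \<inter> wnd j = {x. x div d = j \<and> x mod d < l}"
        using sm unfolding wnd_def j(2) by auto
      finally have "card (segment vs (d + l) (ss ! i) \<inter> segment vs (d + l) (ss ! j))
          = card (g ` {x. x div d = j \<and> x mod d < l})" by simp
      also have "\<dots> = card {x. x div d = j \<and> x mod d < l}"
        by (rule card_image, rule inj_on_subset[OF inj])
          (use j in \<open>auto simp: n_def simp flip: div_less_iff\<close>)
      also have "\<dots> = l" using block_prefix[OF d0, of l j] l by simp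
      finally show "card (segment vs (d + l) (ss ! i) \<inter> segment vs (d + l) (ss ! j)) = l" .
    qed
  qed
  then show ?thesis unfolding hamilton_cycle_def C'_def[symmetric] using sub by auto
qed

end

section \<open>Degrees and covering probabilities of a random template\<close>

text \<open>The wrapping row \<open>m - 1\<close> has no pivot and is left out of the column counts.\<close>

definition good_arrangement :: "nat \<Rightarrow> nat \<Rightarrow> nat \<Rightarrow> 'a set set \<Rightarrow> nat \<Rightarrow> (nat \<Rightarrow> 'a) \<Rightarrow> bool" where
  "good_arrangement d l m E z f \<longleftrightarrow>
     (\<forall>i<m. card {y \<in> {..<m}. f ` edge_positions d l m i y \<notin> E} < z) \<and>
     (\<forall>y<m. card {i \<in> {..<m - 1}. f ` edge_positions d l m i y \<notin> E} < z)"

text \<open>Rows and columns need different fresh positions for the exposure: the edges of a row are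
  separated by their movable positions, those of a column share it and are separated by
  \<open>pivot\<close>. The union bound over m rows and m columns gives the factor 2 m.\<close>

lemma few_bad_arrangements:
  fixes b :: real
  assumes d: "d \<ge> 2" and l: "l \<le> d - 1" and m: "m \<ge> 3"
    and V: "finite V" "card V = d * m"
    and b: "\<And>A. A \<subseteq> V \<Longrightarrow> card A = d + l - 1 \<Longrightarrow> card {v \<in> V. insert v A \<notin> E} \<le> b" "b \<ge> 0"
    and j: "(d + l) * j < d * m" "j < z"
  shows "card {f \<in> arrangements (d * m) V. \<not> good_arrangement d l m E z f}
    \<le> 2 * real m * ((b / (real (d * m) - real ((d + l) * j)) * (m / (real z - j))) ^ j * card (arrangements (d * m) V))"
proof -
  let ?\<Omega> = "arrangements (d * m) V"
  define T where "T = (b / (real (d * m) - real ((d + l) * j)) * (m / (real z - j))) ^ j * card ?\<Omega>"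
  have fin: "finite ?\<Omega>" by (rule finite_arrangements[OF V(1)])
  have k: "d + l \<ge> 1" using d by simp
  note ep = edge_positions_subset[OF d l m] card_edge_positions[OF d l m]
  define R where "R i = {f \<in> ?\<Omega>. z \<le> card {y \<in> {..<m}. f ` edge_positions d l m i y \<notin> E}}" for i
  define C where "C y = {f \<in> ?\<Omega>. z \<le> card {i \<in> {..<m - 1}. f ` edge_positions d l m i y \<notin> E}}" for y
  have R: "card (R i) \<le> T" if i: "i < m" for i
  proof -
    have "card (R i) \<le> (b / (real (d * m) - real ((d + l) * j)) * (card {..<m} / (real z - j))) ^ j * card ?\<Omega>"
      unfolding R_def of_nat_mult[of "d + l" j]
    proof (rule arrangements_tail[OF V k b _ j])
      fix y assume "y \<in> {..<m}"
      then show "edge_positions d l m i y \<subseteq> {..<d * m} \<and> card (edge_positions d l m i y) = d + l \<and>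
          movable d y \<in> edge_positions d l m i y"
        using ep i movable_in_edge_positions_iff[OF d l m] by auto
    next
      fix y y' :: nat assume "y' < y"
      then show "movable d y \<notin> edge_positions d l m i y'"
        using movable_in_edge_positions_iff[OF d l m] by auto
    qed auto
    then show ?thesis unfolding T_def by simp
  qed
  have C: "card (C y) \<le> T" if y: "y < m" for y
  proof -
    have pos: "real (d * m) - real ((d + l) * j) > 0" "real z - j > 0"
      using j by (auto simp del: of_nat_mult of_nat_add)
    have "card (C y) \<le> (b / (real (d * m) - real ((d + l) * j)) * (card {..<m - 1} / (real z - j))) ^ j * card ?\<Omega>"
      unfolding C_def of_nat_mult[of "d + l" j]
    proof (rule arrangements_tail[OF V k b _ j])
      fix i assume "i \<in> {..<m - 1}"
      then show "edge_positions d l m i y \<subseteq> {..<d * m} \<and> card (edge_positions d l m i y) = d + l \<and>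
          pivot d l i \<in> edge_positions d l m i y"
        using ep y pivot_in[OF d l m, of i] by auto
    next
      fix i i' assume "i \<in> {..<m - 1}" "i' < i"
      then show "pivot d l i \<notin> edge_positions d l m i' y"
        using pivot_notin[OF d l m, of i' i] by auto
    qed auto
    also have "\<dots> \<le> T"
      unfolding T_def using pos b(2)
      by (intro mult_right_mono power_mono mult_left_mono divide_right_mono) auto
    finally show ?thesis .
  qed
  have "{f \<in> ?\<Omega>. \<not> good_arrangement d l m E z f} \<subseteq> (\<Union>i<m. R i) \<union> (\<Union>y<m. C y)"
    unfolding good_arrangement_def R_def C_def by (auto simp: not_less)
  then have "card {f \<in> ?\<Omega>. \<not> good_arrangement d l m E z f} \<le> card ((\<Union>i<m. R i) \<union> (\<Union>y<m. C y))"
    by (rule card_mono[rotated]) (use fin in \<open>auto simp: R_def C_def\<close>)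
  also have "\<dots> \<le> card (\<Union>i<m. R i) + card (\<Union>y<m. C y)" by (rule card_Un_le)
  also have "\<dots> \<le> (\<Sum>i<m. card (R i)) + (\<Sum>y<m. card (C y))"
    by (intro add_mono card_UN_le) auto
  finally have "real (card {f \<in> ?\<Omega>. \<not> good_arrangement d l m E z f})
      \<le> (\<Sum>i<m. real (card (R i))) + (\<Sum>y<m. real (card (C y)))"
    by (simp only: of_nat_le_iff flip: of_nat_sum of_nat_add)
  also have "\<dots> \<le> (\<Sum>i<m. T) + (\<Sum>y<m. T)" using R C by (intro add_mono sum_mono) auto
  finally show ?thesis unfolding T_def[symmetric] by (simp add: mult_ac)
qed

lemma card_nonneighbours_le:
  fixes \<alpha> :: real
  assumes H: "uniform_hypergraph k V E" and A: "A \<subseteq> V" "card A = k - 1" and k: "k \<ge> 1"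
    and deg: "\<alpha> * card V \<le> hdegree E A"
  shows "card {v \<in> V. insert v A \<notin> E} \<le> (1 - \<alpha>) * card V"
proof -
  have V: "finite V" and E: "\<And>e. e \<in> E \<Longrightarrow> e \<subseteq> V \<and> card e = k"
    using H unfolding uniform_hypergraph_def by auto
  have "{e \<in> E. A \<subseteq> e} \<subseteq> (\<lambda>v. insert v A) ` {v \<in> V. insert v A \<in> E}"
  proof
    fix e assume e: "e \<in> {e \<in> E. A \<subseteq> e}"
    then have fe: "finite e" "card e = k" using E[of e] V finite_subset by auto
    then have "card (e - A) = 1" using e A k finite_subset[of A e] by (simp add: card_Diff_subset)
    then obtain v where "e - A = {v}" by (meson card_1_singletonE)
    then have "e = insert v A" using e by auto
    then show "e \<in> (\<lambda>v. insert v A) ` {v \<in> V. insert v A \<in> E}" using e E[of e] by auto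
  qed
  then have "hdegree E A \<le> card {v \<in> V. insert v A \<in> E}"
    unfolding hdegree_def by (rule surj_card_le[rotated]) (use V in auto)
  moreover have "card V = card {v \<in> V. insert v A \<in> E} + card {v \<in> V. insert v A \<notin> E}"
    using V by (subst card_Un_disjoint[symmetric]) (auto intro: arg_cong[of _ _ card])
  ultimately show ?thesis using deg by (simp add: algebra_simps)
qed

text \<open>The entries of one template are m^2 different sets of d + l positions. The bound later
  keeps the covering probability \<rho> below a constant and the binomial coefficient
  positive.\<close>

lemma grid_le_binomial:
  assumes d: "d \<ge> 2" and l: "l \<le> d - 1" and m: "m \<ge> 3"
  shows "m * m \<le> (d * m choose (d + l))"
proof -
  let ?e = "\<lambda>(i, y). edge_positions d l m i y"
  have "inj_on ?e ({..<m} \<times> {..<m})"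
    using edge_positions_inject[OF d l m] by (fastforce simp: inj_on_def)
  then have "m * m = card (?e ` ({..<m} \<times> {..<m}))" by (simp add: card_image card_cartesian_product)
  also have "\<dots> \<le> card {Q. Q \<subseteq> {..<d * m} \<and> card Q = d + l}"
    using edge_positions_subset[OF d l m] card_edge_positions[OF d l m] by (intro card_mono) auto
  finally show ?thesis by (simp add: n_subsets)
qed

text \<open>A union bound over the m^2 entries, each of which equals e with probability at most the
  reciprocal of the binomial coefficient.\<close>

lemma card_arrangements_covering_le:
  assumes d: "d \<ge> 2" and l: "l \<le> d - 1" and m: "m \<ge> 3" and V: "finite V" "card V = d * m"
    and e: "e \<subseteq> V" "card e = d + l"
  shows "(d * m choose (d + l)) *
      card {f \<in> arrangements (d * m) V. e \<in> (\<lambda>(i, y). f ` edge_positions d l m i y) ` ({..<m} \<times> {..<m})}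
    \<le> m * m * card (arrangements (d * m) V)"
proof -
  let ?\<Omega> = "arrangements (d * m) V" and ?c = "d * m choose (d + l)"
  let ?X = "\<lambda>(i, y). {f \<in> ?\<Omega>. f ` edge_positions d l m i y = e}"
  have fin: "finite ?\<Omega>" by (rule finite_arrangements[OF V(1)])
  have "card {f \<in> ?\<Omega>. e \<in> (\<lambda>(i, y). f ` edge_positions d l m i y) ` ({..<m} \<times> {..<m})}
      \<le> card (\<Union>p\<in>{..<m} \<times> {..<m}. ?X p)"
    using fin by (intro card_mono) auto
  also have "\<dots> \<le> (\<Sum>p\<in>{..<m} \<times> {..<m}. card (?X p))" by (rule card_UN_le) simp
  finally have "?c * card {f \<in> ?\<Omega>. e \<in> (\<lambda>(i, y). f ` edge_positions d l m i y) ` ({..<m} \<times> {..<m})}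
      \<le> (\<Sum>p\<in>{..<m} \<times> {..<m}. ?c * card (?X p))"
    by (simp add: sum_distrib_left[symmetric] del: mult_le_cancel1 mult_le_cancel2)
  also have "\<dots> \<le> (\<Sum>p\<in>{..<m} \<times> {..<m}. card ?\<Omega>)"
  proof (rule sum_mono)
    fix p assume "p \<in> {..<m} \<times> {..<m}"
    then show "?c * card (?X p) \<le> card ?\<Omega>"
      using card_arrangements_image_le[OF V edge_positions_subset[OF d l m] card_edge_positions[OF d l m] e]
      by (cases p) simp
  qed
  finally show ?thesis by (simp add: card_cartesian_product)
qed

text \<open>The moment order j is a small multiple of n. Exposing j edges shrinks the pool of
  vertices to (1 - A) n at worst, and z - j stays above (1 - \<alpha>' - B) m. The constant \<eta>
  makes A + B half of the gap \<alpha> - \<alpha>', so the base of the j-th power stays at most c <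
  1; as j is linear in m, the bad fraction is exponentially small.\<close>

lemma bad_arrangements_fraction:
  fixes \<alpha> \<alpha>' \<eta> \<delta> :: real and d l m :: nat
  assumes d: "d \<ge> 2" and l: "l \<le> d - 1" and m: "m \<ge> 3"
    and H: "uniform_hypergraph (d + l) V E" and V: "card V = d * m"
    and deg: "\<And>A. A \<subseteq> V \<Longrightarrow> card A = d + l - 1 \<Longrightarrow> \<alpha> * card V \<le> hdegree E A"
    and \<alpha>: "\<alpha>' < \<alpha>" "\<alpha> \<le> 1"
    and \<eta>: "\<eta> = (\<alpha> - \<alpha>') / (2 * (2 * d + l + 1))" "\<alpha>' > 0"
    and large: "1 / m \<le> \<eta>" "2 * real m * exp (- (1 - (1 - \<alpha>) / (1 - (\<alpha> + \<alpha>') / 2)) * (\<eta> * m - 1)) \<le> \<delta>"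
  shows "card {f \<in> arrangements (d * m) V. \<not> good_arrangement d l m E (nat \<lfloor>(1 - \<alpha>') * m\<rfloor>) f}
    \<le> \<delta> * card (arrangements (d * m) V)"
proof -
  define n where "n = d * m"
  define j where "j = nat \<lfloor>\<eta> * n\<rfloor>"
  define z where "z = nat \<lfloor>(1 - \<alpha>') * m\<rfloor>"
  define c where "c = (1 - \<alpha>) / (1 - (\<alpha> + \<alpha>') / 2)"
  let ?k = "d + l"
  define A where "A = \<eta> * real ?k"
  \<comment> \<open>Here B m = \<eta> n + \<eta> m: the first summand pays for j, the second for the
    rounding error 1 in z.\<close>
  define B where "B = \<eta> * real (d + 1)"
  have \<eta>0: "\<eta> > 0" using \<eta> \<alpha> by simp
  have m0: "real m > 0" using m by simp
  have n0: "real n > 0" unfolding n_def using m d by simp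
  have den: "1 - (\<alpha> + \<alpha>') / 2 > 0" using \<alpha> by simp
  have c0: "0 \<le> c" "c < 1" unfolding c_def using \<alpha> den by (auto simp: field_simps)
  have \<eta>2: "\<eta> * (2 * d + l + 1) = (\<alpha> - \<alpha>') / 2" unfolding \<eta>(1) by (simp add: field_simps)
  have jle: "j \<le> \<eta> * n" unfolding j_def using \<eta>0 by simp
  have jge: "j \<ge> \<eta> * m - 1"
  proof -
    have "m \<le> n" unfolding n_def using d by simp
    then have "real m \<le> n" by simp
    then have "\<eta> * m \<le> \<eta> * n" using \<eta>0 by simp
    moreover have "\<eta> * n - 1 \<le> j" unfolding j_def using \<eta>0 by linarith
    ultimately show ?thesis by linarith
  qed
  have zge: "z \<ge> (1 - \<alpha>') * m - 1" unfolding z_def using \<alpha> by linarith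
  have sum: "A + B = (\<alpha> - \<alpha>') / 2" using \<eta>2 unfolding A_def B_def by (simp add: algebra_simps)
  then have sum2: "2 * A + 2 * B = \<alpha> - \<alpha>'" by (simp add: field_simps)
  have AB: "0 \<le> A" "0 \<le> B" unfolding A_def B_def using \<eta>0 by auto
  have kj: "?k * j \<le> A * n" using mult_left_mono[OF jle, of "real ?k"] unfolding A_def by (simp add: mult_ac)
  have A1: "A < 1"
    using sum2 AB \<alpha> \<eta>(2) by linarith
  then have gap1: "real n - real (?k * j) \<ge> (1 - A) * n" "(1 - A) * n > 0"
    using kj n0 by (auto simp: algebra_simps)
  have "1 \<le> \<eta> * m" using large(1) m0 by (simp add: field_simps)
  moreover have "B * m = \<eta> * n + \<eta> * m" unfolding B_def n_def by (simp add: algebra_simps)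
  moreover have "(1 - \<alpha>' - B) * m = (1 - \<alpha>') * m - B * m" by (simp add: algebra_simps)
  ultimately have gap2: "real z - j \<ge> (1 - \<alpha>' - B) * m" using zge jle by linarith
  have pos2: "1 - \<alpha>' - B > 0"
    using sum AB den \<alpha> by (simp add: field_simps)
  have kjn: "?k * j < n" using gap1 by (metis diff_gt_0_iff_gt less_le_trans of_nat_less_iff)
  have jz: "j < z" using gap2 pos2 m0 by (metis diff_gt_0_iff_gt less_le_trans mult_pos_pos of_nat_less_iff)
  have finV: "finite V" using H unfolding uniform_hypergraph_def by simp
  have "card {f \<in> arrangements (d * m) V. \<not> good_arrangement d l m E z f}
    \<le> 2 * real m * (((1 - \<alpha>) * n / (real (d * m) - real (?k * j)) * (m / (real z - j))) ^ j * card (arrangements (d * m) V))"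
  proof (rule few_bad_arrangements[OF d l m finV V])
    show "card {v \<in> V. insert v A \<notin> E} \<le> (1 - \<alpha>) * n" if "A \<subseteq> V" "card A = ?k - 1" for A
      using card_nonneighbours_le[OF H that _ deg[OF that]] d V unfolding n_def by simp
  qed (use kjn jz \<alpha> in \<open>auto simp: n_def\<close>)
  also have "\<dots> \<le> 2 * real m * (exp (- (1 - c)) ^ j * card (arrangements (d * m) V))"
  proof (intro mult_left_mono mult_right_mono power_mono)
    have "(1 - \<alpha>) * n / (real (d * m) - real (?k * j)) \<le> (1 - \<alpha>) * n / ((1 - A) * n)"
      using gap1 \<alpha> n0 unfolding n_def[symmetric] by (intro divide_left_mono) auto
    moreover have "m / (real z - j) \<le> m / ((1 - \<alpha>' - B) * m)"
    proof (rule divide_left_mono)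
      have "0 < (1 - \<alpha>' - B) * m" using pos2 m0 by simp
      moreover have "0 < real z - j" using jz by simp
      ultimately show "0 < (real z - j) * ((1 - \<alpha>' - B) * m)" by (simp only: mult_pos_pos)
    qed (use gap2 in auto)
    ultimately have "(1 - \<alpha>) * n / (real (d * m) - real (?k * j)) * (m / (real z - j))
        \<le> (1 - \<alpha>) * n / ((1 - A) * n) * (m / ((1 - \<alpha>' - B) * m))"
      using gap1 \<alpha> jz n0 A1 by (intro mult_mono) auto
    also have "\<dots> = (1 - \<alpha>) / ((1 - A) * (1 - \<alpha>' - B))"
      using n0 m0 by simp
    also have "\<dots> \<le> (1 - \<alpha>) / (1 - (\<alpha> + \<alpha>') / 2)"
    proof (rule divide_left_mono)
      have "(1 - A) * (1 - \<alpha>' - B) = 1 - \<alpha>' - B - A + A * (\<alpha>' + B)"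
        by (simp add: algebra_simps)
      moreover have "A * (\<alpha>' + B) \<ge> 0" using AB \<eta>(2) by simp
      ultimately show le: "1 - (\<alpha> + \<alpha>') / 2 \<le> (1 - A) * (1 - \<alpha>' - B)"
        using sum by (simp add: field_simps)
      show "0 < (1 - A) * (1 - \<alpha>' - B) * (1 - (\<alpha> + \<alpha>') / 2)"
        using A1 pos2 den by simp
    qed (use \<alpha> in simp)
    also have "\<dots> = 1 + - (1 - c)" unfolding c_def by simp
    also have "\<dots> \<le> exp (- (1 - c))" by (rule exp_ge_add_one_self)
    finally show "(1 - \<alpha>) * n / (real (d * m) - real (?k * j)) * (m / (real z - j)) \<le> exp (- (1 - c))" .
    show "0 \<le> (1 - \<alpha>) * n / (real (d * m) - real (?k * j)) * (m / (real z - j))"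
      using \<alpha> gap1 jz unfolding n_def[symmetric] by simp
  qed auto
  also have "\<dots> = 2 * real m * exp (- (1 - c)) ^ j * card (arrangements (d * m) V)" by simp
  also have "\<dots> \<le> \<delta> * card (arrangements (d * m) V)"
  proof (rule mult_right_mono)
    have "exp (- (1 - c)) ^ j = exp (- (1 - c) * j)" by (simp only: exp_of_nat2_mult)
    also have "\<dots> \<le> exp (- (1 - c) * (\<eta> * m - 1))" using jge c0 by simp
    finally have "2 * real m * exp (- (1 - c)) ^ j \<le> 2 * real m * exp (- (1 - c) * (\<eta> * m - 1))"
      by (intro mult_left_mono) auto
    then show "2 * real m * exp (- (1 - c)) ^ j \<le> \<delta>" using large(2) unfolding c_def by linarith
  qed simp
  finally show ?thesis unfolding z_def .
qed

section \<open>The cut condition\<close>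

lemma f_reg_bounds:
  assumes "1 / 2 < \<alpha>" "\<alpha> \<le> 1"
  shows "0 < f_reg \<alpha>" "f_reg \<alpha> \<le> 1"
proof -
  define s where "s = sqrt (2 * \<alpha> - 1)"
  have "0 \<le> s" "s \<le> 1" using assms unfolding s_def by auto
  then show "0 < f_reg \<alpha>" "f_reg \<alpha> \<le> 1"
    using assms unfolding f_reg_def s_def[symmetric] by auto
qed

text \<open>
  The slack is \<open>x * ((\<alpha> - f) * M - u) + f * M * u\<close> with \<open>u = M - y\<close>; when the bracket is negative
  it is minimal at \<open>x = y\<close>, where it is the square of \<open>u - (1 - sqrt (2 * \<alpha> - 1)) * M / 2\<close>.
\<close>

lemma f_reg_cut:
  fixes M x y \<alpha> :: real
  assumes \<alpha>: "1 / 2 < \<alpha>" "\<alpha> \<le> 1" and xy: "0 \<le> x" "x \<le> y" "y \<le> M" "M \<le> x + y"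
  shows "f_reg \<alpha> * M * (x + y - M) \<le> x * (\<alpha> * M + y - M)"
proof -
  define s where "s = sqrt (2 * \<alpha> - 1)"
  define f where "f = f_reg \<alpha>"
  have s2: "s\<^sup>2 = 2 * \<alpha> - 1" unfolding s_def using \<alpha> by simp
  have f: "f = (\<alpha> + s) / 2" unfolding f_def f_reg_def s_def by simp
  have \<alpha>s: "\<alpha> = (1 + s\<^sup>2) / 2" using s2 by simp
  have f0: "f > 0" unfolding f_def by (rule f_reg_bounds[OF \<alpha>])
  define u where "u = M - y"
  have u: "0 \<le> u" "u \<le> x" "x \<le> M - u" using xy unfolding u_def by auto
  have M0: "M \<ge> 0" using xy by linarith
  have "0 \<le> x * ((\<alpha> - f) * M - u) + f * M * u"
  proof (cases "(\<alpha> - f) * M - u \<ge> 0")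
    case True
    then show ?thesis using xy u f0 M0 by simp
  next
    case False
    \<comment> \<open>As a quadratic in u this is u^2 - (1 + \<alpha> - 2 f) M u + (\<alpha> - f)
      M^2. For M > 0, \<open>f_reg \<alpha>\<close> is the largest f for which its discriminant is
      not positive, hence the double root.\<close>
    have "(M - u) * ((\<alpha> - f) * M - u) + f * M * u = (u - (1 - s) * M / 2)\<^sup>2"
      unfolding f \<alpha>s by (simp add: field_simps power2_eq_square)
    then have "0 \<le> (M - u) * ((\<alpha> - f) * M - u) + f * M * u" by simp
    also have "\<dots> \<le> x * ((\<alpha> - f) * M - u) + f * M * u"
      using False u by (intro add_right_mono mult_right_mono_neg) auto
    finally show ?thesis .
  qed
  then show ?thesis unfolding f_def[symmetric] u_def by (simp add: algebra_simps)
qed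

section \<open>Failure weights summed over all cuts\<close>

lemma sum_Pow_power_card:
  fixes x :: real
  assumes "finite S"
  shows "(\<Sum>A\<in>Pow S. x ^ card A) = (1 + x) ^ card S"
    "(\<Sum>A\<in>Pow S. x ^ card (S - A)) = (1 + x) ^ card S"
proof -
  have "(\<Prod>i\<in>S. x + 1) = (\<Sum>A\<in>Pow S. (\<Prod>i\<in>A. x) * (\<Prod>i\<in>S - A. 1))"
    by (rule prod_add[OF assms])
  then show "(\<Sum>A\<in>Pow S. x ^ card A) = (1 + x) ^ card S" by (simp add: add.commute)
  have "(\<Prod>i\<in>S. 1 + x) = (\<Sum>A\<in>Pow S. (\<Prod>i\<in>A. 1) * (\<Prod>i\<in>S - A. x))"
    by (rule prod_add[OF assms])
  then show "(\<Sum>A\<in>Pow S. x ^ card (S - A)) = (1 + x) ^ card S" by simp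
qed

text \<open>The weight is a product over A and the complement of B, so the double sum factorises.
  Leaving out the empty A replaces one factor (1 + x) ^ card S by its excess over 1, which makes the
  total small when x * card S is small.\<close>

lemma sum_cut_weights:
  fixes x :: real
  assumes "finite S" "x \<ge> 0"
  shows "(\<Sum>A\<in>Pow S - {{}}. \<Sum>B\<in>Pow S. x ^ (card A + card (S - B)))
    = ((1 + x) ^ card S - 1) * (1 + x) ^ card S"
proof -
  have "(\<Sum>A\<in>Pow S - {{}}. x ^ card A) = (1 + x) ^ card S - 1"
    using assms sum_Pow_power_card(1)[OF assms(1), of x] by (simp add: sum_diff1)
  then show ?thesis
    using sum_Pow_power_card(2)[OF assms(1), of x]
    by (simp add: power_add sum_product[symmetric])
qed

lemma cut_weights_bound:
  fixes x :: real and m :: nat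
  assumes "x \<ge> 0" "m * x \<le> 1"
  shows "((1 + x) ^ m - 1) * (1 + x) ^ m \<le> 6 * (m * x)"
proof -
  have "(1 + x) ^ m \<le> exp x ^ m" using assms by (intro power_mono) auto
  then have e: "(1 + x) ^ m \<le> exp (m * x)" by (simp add: exp_of_nat_mult)
  have "exp (m * x) \<le> 1 + m * x + (m * x)\<^sup>2" using assms by (intro exp_bound) auto
  also have "(m * x)\<^sup>2 \<le> m * x" using assms by (simp add: power2_eq_square mult_left_le)
  finally have e2: "exp (m * x) \<le> 1 + 2 * (m * x)" by linarith
  have "((1 + x) ^ m - 1) * (1 + x) ^ m \<le> (2 * (m * x)) * 3"
    using e e2 assms by (intro mult_mono) auto
  then show ?thesis by simp
qed

text \<open>
  A bipartite graph whose minimum degree exceeds \<open>\<alpha>' * m\<close> satisfies the cut condition for an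
  \<open>f_reg \<alpha>' * m\<close>-factor, with a surplus that is linear in the smaller side of the cut.
\<close>

lemma cut_surplus:
  fixes \<alpha> \<alpha>' :: real and m :: nat
  assumes \<alpha>: "1 / 2 < \<alpha>'" "\<alpha>' \<le> 1"
    and G: "G \<subseteq> {..<m} \<times> {..<m}"
    and row: "\<And>i. i < m \<Longrightarrow> \<alpha> * m \<le> card {y. (i, y) \<in> G}"
    and AB: "A \<subseteq> {..<m}" "B \<subseteq> {..<m}" "card A \<le> card B" "m \<le> card A + card B"
  shows "f_reg \<alpha>' * m * (real (card A) + real (card B) - real m) + (\<alpha> - \<alpha>') * m * card A \<le> card (G \<inter> A \<times> B)"
proof -
  have finA: "finite A" and finB: "finite B" using AB finite_subset by auto
  have Bm: "card B \<le> m" using AB(2) by (metis card_lessThan card_mono finite_lessThan)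
  have "card A * (\<alpha> * m + card B - m) = (\<Sum>i\<in>A. \<alpha> * m + card B - real m)" by simp
  also have "\<dots> \<le> (\<Sum>i\<in>A. real (card {y \<in> B. (i, y) \<in> G}))"
  proof (rule sum_mono)
    fix i assume i: "i \<in> A"
    have "{y. (i, y) \<in> G} \<subseteq> {y \<in> B. (i, y) \<in> G} \<union> ({..<m} - B)" using G by auto
    then have "card {y. (i, y) \<in> G} \<le> card ({y \<in> B. (i, y) \<in> G} \<union> ({..<m} - B))"
      using finB by (intro card_mono) auto
    also have "\<dots> \<le> card {y \<in> B. (i, y) \<in> G} + card ({..<m} - B)" by (rule card_Un_le)
    also have "card ({..<m} - B) = m - card B" using AB finB by (simp add: card_Diff_subset)
    finally show "\<alpha> * m + card B - real m \<le> card {y \<in> B. (i, y) \<in> G}"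
      using row[of i] i AB Bm by (auto simp: of_nat_diff)
  qed
  also have "\<dots> = card (SIGMA i:A. {y \<in> B. (i, y) \<in> G})"
    using finA finB by (subst card_SigmaI) auto
  also have "(SIGMA i:A. {y \<in> B. (i, y) \<in> G}) = G \<inter> A \<times> B" by auto
  finally have "card A * (\<alpha> * m + card B - m) \<le> card (G \<inter> A \<times> B)" .
  moreover have "f_reg \<alpha>' * m * (real (card A) + real (card B) - real m) \<le> card A * (\<alpha>' * m + card B - real m)"
    using AB Bm by (intro f_reg_cut[OF \<alpha>]) auto
  ultimately show ?thesis by (simp add: algebra_simps)
qed

lemma cut_surplus':
  fixes \<alpha> \<alpha>' :: real and m :: nat
  assumes \<alpha>: "1 / 2 < \<alpha>'" "\<alpha>' \<le> 1"
    and G: "G \<subseteq> {..<m} \<times> {..<m}"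
    and row: "\<And>i. i < m \<Longrightarrow> \<alpha> * m \<le> card {y. (i, y) \<in> G}"
    and col: "\<And>y. y < m \<Longrightarrow> \<alpha> * m \<le> card {i. (i, y) \<in> G}"
    and AB: "A \<subseteq> {..<m}" "B \<subseteq> {..<m}" "m \<le> card A + card B"
  shows "f_reg \<alpha>' * m * (real (card A) + real (card B) - real m) + (\<alpha> - \<alpha>') * m * min (card A) (card B) \<le> card (G \<inter> A \<times> B)"
proof (cases "card A \<le> card B")
  case True
  then show ?thesis using cut_surplus[OF \<alpha> G row AB(1,2) True AB(3)] by simp
next
  case False
  have "f_reg \<alpha>' * m * (real (card B) + real (card A) - real m) + (\<alpha> - \<alpha>') * m * card B \<le> card (G\<inverse> \<inter> B \<times> A)"
    by (rule cut_surplus[OF \<alpha>]) (use G col AB False in auto)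
  moreover have "card (G\<inverse> \<inter> B \<times> A) = card (G \<inter> A \<times> B)"
  proof -
    have "G\<inverse> \<inter> B \<times> A = (G \<inter> A \<times> B)\<inverse>" by auto
    then show ?thesis by simp
  qed
  ultimately show ?thesis using False by (simp add: min_def add.commute)
qed

text \<open>This is an exponential lower-tail estimate: if N edges of a cut are kept with
  probability at least 1 / q each, the left side bounds the probability that at most T survive. The
  threshold T lies below N / q by \<kappa> m a / q, and N \<le> a m makes this a constant fraction
  of N / q. The result decays geometrically in a, the size of the smaller side.\<close>

lemma sparsified_cut_weight:
  fixes q \<kappa> \<phi> :: real and m r a N T :: nat
  assumes q: "q > 0" and \<kappa>: "0 < \<kappa>" "\<kappa> \<le> 1" and T: "q * T \<le> N - \<kappa> * m * a" and N: "N \<le> a * m"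
    and q1: "\<kappa> / 4 \<le> q"
  shows "1 / (1 - \<kappa> / 4) ^ T * (1 - \<kappa> / 4 / q) ^ N \<le> exp (- (\<kappa>\<^sup>2 / 8) * m / q) ^ a"
proof -
  \<comment> \<open>The exponent gained per a m / q is s \<kappa> - 2 s^2; s = \<kappa> / 4
    maximises it, with value \<open>\<kappa>\<^sup>2 / 8\<close>.\<close>
  define s where "s = \<kappa> / 4"
  have s: "0 < s" "s \<le> 1 / 2" unfolding s_def using \<kappa> by auto
  define c where "c = s + 2 * s\<^sup>2"
  have c: "c \<ge> 0" unfolding c_def using s by simp
  have "exp (- c) \<le> 1 - s"
  proof -
    have "- s - 2 * s\<^sup>2 \<le> ln (1 - s)" by (rule ln_one_minus_pos_lower_bound) (use s in auto)
    then have "exp (- s - 2 * s\<^sup>2) \<le> exp (ln (1 - s))" by simp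
    then show ?thesis using s unfolding c_def by simp
  qed
  then have "exp (- c) ^ T \<le> (1 - s) ^ T" by (intro power_mono) auto
  then have "1 / (1 - s) ^ T \<le> 1 / exp (- c) ^ T"
    using s by (intro divide_left_mono) auto
  also have "\<dots> = exp (c * T)"
    by (simp add: exp_minus inverse_eq_divide power_one_over[symmetric] exp_of_nat2_mult)
  finally have 1: "1 / (1 - s) ^ T \<le> exp (c * T)" .
  have "1 - s / q \<ge> 0" using q q1 unfolding s_def by (simp add: divide_le_eq)
  moreover have "1 - s / q \<le> exp (- (s / q))" using exp_ge_add_one_self[of "- (s / q)"] by simp
  ultimately have "(1 - s / q) ^ N \<le> exp (- (s / q)) ^ N" by (intro power_mono) auto
  then have 2: "(1 - s / q) ^ N \<le> exp (- (s / q) * N)" by (simp only: exp_of_nat2_mult)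
  have "1 / (1 - s) ^ T * (1 - s / q) ^ N \<le> exp (c * T) * exp (- (s / q) * N)"
    using 1 2 s \<open>1 - s / q \<ge> 0\<close> by (intro mult_mono) auto
  also have "\<dots> = exp (c * T - s / q * N)" by (simp add: exp_add[symmetric])
  also have "\<dots> \<le> exp (- (\<kappa>\<^sup>2 / 8) * m / q * a)"
  proof -
    have "T \<le> (N - \<kappa> * m * a) / q" using T q by (simp add: field_simps)
    then have "c * T \<le> c * ((N - \<kappa> * m * a) / q)"
      using c by (intro mult_left_mono) auto
    then have "c * T - s / q * N \<le> (2 * s\<^sup>2 * N - c * (\<kappa> * m * a)) / q"
      by (simp add: c_def algebra_simps diff_divide_distrib add_divide_distrib)
    also have "\<dots> \<le> (2 * s\<^sup>2 * (a * m) - s * (\<kappa> * m * a)) / q"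
    proof (rule divide_right_mono)
      have "2 * s\<^sup>2 * N \<le> 2 * s\<^sup>2 * (a * m)" using N by (intro mult_left_mono) (auto simp flip: of_nat_mult)
      moreover have "s * (\<kappa> * m * a) \<le> c * (\<kappa> * m * a)"
        using s \<kappa> unfolding c_def by (intro mult_right_mono) auto
      ultimately show "2 * s\<^sup>2 * N - c * (\<kappa> * m * a) \<le> 2 * s\<^sup>2 * (a * m) - s * (\<kappa> * m * a)"
        by linarith
    qed (use q in simp)
    also have "\<dots> = - (\<kappa>\<^sup>2 / 8) * m / q * a"
      unfolding s_def by (simp add: field_simps power2_eq_square)
    finally show ?thesis by simp
  qed
  also have "\<dots> = exp (- (\<kappa>\<^sup>2 / 8) * m / q) ^ a" by (simp only: exp_of_nat2_mult)
  finally show ?thesis unfolding s_def .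
qed

section \<open>Packing Hamilton cycles\<close>

text \<open>
  Here \<open>ed t (i, y)\<close> is the hyperedge formed by row \<open>i\<close> and column \<open>y\<close> of template \<open>t\<close>; the test
  on its membership in \<open>E\<close> is what makes the template a bipartite graph.
\<close>

lemma template_matchings:
  fixes ed :: "nat \<Rightarrow> nat \<times> nat \<Rightarrow> 'e" and \<alpha> \<alpha>' q :: real and m N r :: nat
  assumes \<alpha>: "1 / 2 < \<alpha>'" "\<alpha>' < \<alpha>" "\<alpha> \<le> 1"
    and E: "finite E"
    and inj: "\<And>t. t < N \<Longrightarrow> inj_on (ed t) ({..<m} \<times> {..<m})"
    and row: "\<And>t i. t < N \<Longrightarrow> i < m \<Longrightarrow> \<alpha> * m \<le> card {y. y < m \<and> ed t (i, y) \<in> E}"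
    and col: "\<And>t y. t < N \<Longrightarrow> y < m \<Longrightarrow> \<alpha> * m \<le> card {i. i < m \<and> ed t (i, y) \<in> E}"
    and q: "1 \<le> q" "\<And>e. e \<in> E \<Longrightarrow> card {t. t < N \<and> e \<in> ed t ` ({..<m} \<times> {..<m})} \<le> q"
    and r: "q * r \<le> f_reg \<alpha>' * m"
    and small: "12 * N * (m * exp (- ((\<alpha> - \<alpha>')\<^sup>2 / 16) * m / q)) < 1"
      "m * exp (- ((\<alpha> - \<alpha>')\<^sup>2 / 16) * m / q) \<le> 1"
  shows "\<exists>\<sigma>. (\<forall>t<N. \<forall>c<r. bij_betw (\<sigma> t c) {..<m} {..<m}) \<and>
    (\<forall>t<N. \<forall>c<r. \<forall>i<m. ed t (i, \<sigma> t c i) \<in> E) \<and>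
    (\<forall>t<N. \<forall>c<r. \<forall>t'<N. \<forall>c'<r. (t, c) \<noteq> (t', c') \<longrightarrow>
       (\<forall>i<m. \<forall>i'<m. ed t (i, \<sigma> t c i) \<noteq> ed t' (i', \<sigma> t' c' i')))"
proof -
  define I where "I = {..<m}"
  define \<kappa> where "\<kappa> = \<alpha> - \<alpha>'"
  define s where "s = \<kappa> / 4"
  \<comment> \<open>F takes half of the exponent \<open>\<kappa>\<^sup>2 / 8\<close>, so the weight
    of a cut with smaller side a is at most F ^ (2 a). If A is the smaller side, then
    \<open>card (I - B) < card A\<close>, so F ^ (2 a) is at most F ^ (card A + card (I - B)), a
    weight that factorises over A and B.\<close>
  define F where "F = exp (- (\<kappa>\<^sup>2 / 16) * m / q)"
  have finI: "finite I" and cI: "card I = m" unfolding I_def by auto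
  have \<kappa>: "0 < \<kappa>" "\<kappa> \<le> 1" unfolding \<kappa>_def using \<alpha> by auto
  have s: "0 < s" "s \<le> 1 / 4" unfolding s_def using \<kappa> by auto
  define Ch where "Ch e = {t. t < N \<and> e \<in> ed t ` (I \<times> I)}" for e
  define E' where "E' = {e \<in> E. Ch e \<noteq> {}}"
  \<comment> \<open>Cuts with at most m vertices satisfy the condition trivially. The strict
    inequality forces A and B to be nonempty, which removes the summand 1 from the weights.\<close>
  define H where "H = {(t, A, B). t < N \<and> A \<subseteq> I \<and> B \<subseteq> I \<and> m < card A + card B}"
  define \<tau> where "\<tau> = (\<lambda>(t, A :: nat set, B :: nat set). t :: nat)"
  define Q where "Q = (\<lambda>(t, A, B). E \<inter> ed t ` (A \<times> B))"
  define T where "T = (\<lambda>(t :: nat, A :: nat set, B :: nat set). r * (card A + card B - m))"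
  define G where "G t = {p \<in> I \<times> I. ed t p \<in> E}" for t
  have cle: "card A \<le> m" if "A \<subseteq> I" for A using card_mono[OF finI that] cI by simp
  have "H \<subseteq> {..<N} \<times> Pow I \<times> Pow I" unfolding H_def by auto
  then have finH: "finite H" by (rule finite_subset) (use finI in auto)
  have QE: "Q h \<inter> E' = Q h" if "h \<in> H" for h
    using that unfolding Q_def H_def E'_def Ch_def by fastforce
  have QCh: "\<tau> h \<in> Ch e" if "h \<in> H" "e \<in> Q h" for h e
    using that unfolding Q_def H_def \<tau>_def Ch_def by fastforce
  have cQ: "card (Q (t, A, B)) = card (G t \<inter> A \<times> B)" if "(t, A, B) \<in> H" for t A B
  proof -
    have "Q (t, A, B) = ed t ` (G t \<inter> A \<times> B)" using that unfolding Q_def G_def H_def by auto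
    moreover have "inj_on (ed t) (G t \<inter> A \<times> B)"
      by (rule inj_on_subset[OF inj]) (use that in \<open>auto simp: G_def H_def I_def\<close>)
    ultimately show ?thesis by (simp add: card_image)
  qed
  have weight: "1 / (1 - s) ^ T (t, A, B) * (1 - s / q) ^ card (Q (t, A, B))
      \<le> (if A \<noteq> {} then F ^ (card A + card (I - B)) else 0) + (if B \<noteq> {} then F ^ (card B + card (I - A)) else 0)"
    if h: "(t, A, B) \<in> H" for t A B
  proof -
    have t: "t < N" and A: "A \<subseteq> I" and B: "B \<subseteq> I" and AB: "m < card A + card B"
      using h unfolding H_def by auto
    have finAB: "finite A" "finite B" using A B finI finite_subset by auto
    define a where "a = min (card A) (card B)"
    have sur: "f_reg \<alpha>' * m * (real (card A) + real (card B) - real m) + (\<alpha> - \<alpha>') * m * a \<le> card (G t \<inter> A \<times> B)"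
      unfolding a_def
    proof (rule cut_surplus')
      show "\<alpha> * m \<le> card {y. (i, y) \<in> G t}" if "i < m" for i
        using row[OF t that] that unfolding G_def I_def by simp
      show "\<alpha> * m \<le> card {i. (i, y) \<in> G t}" if "y < m" for y
        using col[OF t that] that unfolding G_def I_def by simp
    qed (use \<alpha> A B AB in \<open>auto simp: G_def I_def\<close>)
    have "q * T (t, A, B) = q * r * (real (card A) + real (card B) - real m)"
      unfolding T_def using AB by (simp add: of_nat_diff)
    also have "\<dots> \<le> f_reg \<alpha>' * m * (real (card A) + real (card B) - real m)"
      using r AB by (intro mult_right_mono) auto
    finally have qT: "q * T (t, A, B) \<le> card (Q (t, A, B)) - \<kappa> * m * a"
      using sur cQ[OF h] unfolding \<kappa>_def by linarith
    have "card (G t \<inter> A \<times> B) \<le> card A * card B"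
      using finAB by (metis card_cartesian_product card_mono finite_cartesian_product inf_le2)
    also have "\<dots> \<le> a * m"
      using cle[OF A] cle[OF B] unfolding a_def by (auto simp: min_def mult.commute mult_le_mono)
    finally have "card (Q (t, A, B)) \<le> a * m" using cQ[OF h] by simp
    then have "1 / (1 - s) ^ T (t, A, B) * (1 - s / q) ^ card (Q (t, A, B)) \<le> exp (- (\<kappa>\<^sup>2 / 8) * m / q) ^ a"
      unfolding s_def using q(1) \<kappa> qT by (intro sparsified_cut_weight) auto
    also have "exp (- (\<kappa>\<^sup>2 / 8) * m / q) = F ^ 2"
      unfolding F_def by (simp add: exp_of_nat2_mult[symmetric])
    also have "(F ^ 2) ^ a = F ^ (a + a)" by (simp add: power_mult[symmetric] mult_2)
    also have "\<dots> \<le> (if A \<noteq> {} then F ^ (card A + card (I - B)) else 0) + (if B \<noteq> {} then F ^ (card B + card (I - A)) else 0)"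
    proof -
      have F: "0 \<le> F" "F \<le> 1" unfolding F_def using q(1) by auto
      have ne: "A \<noteq> {}" "B \<noteq> {}" using AB cle[OF A] cle[OF B] by auto
      have "card (I - B) = m - card B" "card (I - A) = m - card A"
        using A B finAB cI by (auto simp: card_Diff_subset)
      then have "card A + card (I - B) \<le> a + a \<or> card B + card (I - A) \<le> a + a"
        using AB cle[OF A] cle[OF B] unfolding a_def by (auto simp: min_def)
      then have "F ^ (a + a) \<le> F ^ (card A + card (I - B)) \<or> F ^ (a + a) \<le> F ^ (card B + card (I - A))"
        using F by (meson power_decreasing)
      moreover have "0 \<le> F ^ (card A + card (I - B))" "0 \<le> F ^ (card B + card (I - A))"
        using F by auto
      ultimately show ?thesis using ne by auto
    qed
    finally show ?thesis .
  qed
  have F0: "F \<ge> 0" unfolding F_def by simp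
  have mF: "m * F \<le> 1" "12 * N * (m * F) < 1" using small unfolding F_def \<kappa>_def by auto
  have "(\<Sum>h\<in>H. 1 / (1 - s) ^ T h * (1 - s / q) ^ card (Q h))
      \<le> (\<Sum>(t, A, B)\<in>H. (if A \<noteq> {} then F ^ (card A + card (I - B)) else 0) + (if B \<noteq> {} then F ^ (card B + card (I - A)) else 0))"
    using weight by (intro sum_mono) auto
  also have "\<dots> \<le> (\<Sum>(t, A, B)\<in>{..<N} \<times> Pow I \<times> Pow I.
      (if A \<noteq> {} then F ^ (card A + card (I - B)) else 0) + (if B \<noteq> {} then F ^ (card B + card (I - A)) else 0))"
    by (rule sum_mono2) (use finI F0 \<open>H \<subseteq> _\<close> in auto)
  also have "\<dots> = N * ((\<Sum>A\<in>Pow I. \<Sum>B\<in>Pow I. if A \<noteq> {} then F ^ (card A + card (I - B)) else 0)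
      + (\<Sum>A\<in>Pow I. \<Sum>B\<in>Pow I. if B \<noteq> {} then F ^ (card B + card (I - A)) else 0))"
    by (simp add: sum.cartesian_product[symmetric] sum.distrib)
  also have "(\<Sum>A\<in>Pow I. \<Sum>B\<in>Pow I. if A \<noteq> {} then F ^ (card A + card (I - B)) else 0)
      = (\<Sum>A\<in>Pow I - {{}}. \<Sum>B\<in>Pow I. F ^ (card A + card (I - B)))"
    using finI by (intro sum.mono_neutral_cong_right) auto
  also have "(\<Sum>A\<in>Pow I. \<Sum>B\<in>Pow I. if B \<noteq> {} then F ^ (card B + card (I - A)) else 0)
      = (\<Sum>B\<in>Pow I - {{}}. \<Sum>A\<in>Pow I. F ^ (card B + card (I - A)))"
    using finI by (subst sum.swap, intro sum.mono_neutral_cong_right) auto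
  also have "N * ((\<Sum>A\<in>Pow I - {{}}. \<Sum>B\<in>Pow I. F ^ (card A + card (I - B)))
      + (\<Sum>B\<in>Pow I - {{}}. \<Sum>A\<in>Pow I. F ^ (card B + card (I - A)))) = N * (2 * (((1 + F) ^ m - 1) * (1 + F) ^ m))"
    using sum_cut_weights[OF finI F0] cI by simp
  also have "\<dots> \<le> N * (2 * (6 * (m * F)))"
    using cut_weights_bound[OF F0 mF(1)] by (intro mult_left_mono) auto
  also have "\<dots> < 1" using mF(2) by (simp add: mult_ac)
  finally have total: "(\<Sum>h\<in>H. 1 / (1 - s) ^ T h * (1 - s / q) ^ card (Q h)) < 1" .
  have "\<exists>c. (\<forall>e\<in>E'. c e \<in> Ch e) \<and>
    (\<Sum>h\<in>H. 1 / (1 - s) ^ T h * (1 - s) ^ card {e \<in> Q h \<inter> E'. c e = \<tau> h})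
      \<le> (\<Sum>h\<in>H. 1 / (1 - s) ^ T h * (1 - s / q) ^ card (Q h \<inter> E'))"
  proof (rule assignment_potential)
    show "finite E'" using E unfolding E'_def by simp
    show "finite (Ch e) \<and> Ch e \<noteq> {} \<and> card (Ch e) \<le> q" if "e \<in> E'" for e
      using that q(2)[of e] unfolding E'_def Ch_def I_def by auto
  qed (use finH s QCh in auto)
  then obtain c where c: "(\<Sum>h\<in>H. 1 / (1 - s) ^ T h * (1 - s) ^ card {e \<in> Q h \<inter> E'. c e = \<tau> h})
      \<le> (\<Sum>h\<in>H. 1 / (1 - s) ^ T h * (1 - s / q) ^ card (Q h \<inter> E'))" by blast
  \<comment> \<open>A cut that keeps at most \<open>T h\<close> edges would alone contribute at
    least 1 to a potential whose total is below 1.\<close>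
  have many: "T h < card {e \<in> Q h. c e = \<tau> h}" if h: "h \<in> H" for h
  proof (rule ccontr)
    assume "\<not> T h < card {e \<in> Q h. c e = \<tau> h}"
    then have "(1 - s) ^ T h \<le> (1 - s) ^ card {e \<in> Q h. c e = \<tau> h}"
      using s by (intro power_decreasing) auto
    then have "1 \<le> 1 / (1 - s) ^ T h * (1 - s) ^ card {e \<in> Q h \<inter> E'. c e = \<tau> h}"
      using s QE[OF h] by simp
    also have "\<dots> \<le> (\<Sum>h\<in>H. 1 / (1 - s) ^ T h * (1 - s) ^ card {e \<in> Q h \<inter> E'. c e = \<tau> h})"
      using h finH s by (intro member_le_sum) auto
    also have "\<dots> \<le> (\<Sum>h\<in>H. 1 / (1 - s) ^ T h * (1 - s / q) ^ card (Q h \<inter> E'))" by (rule c)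
    also have "\<dots> = (\<Sum>h\<in>H. 1 / (1 - s) ^ T h * (1 - s / q) ^ card (Q h))"
      using QE by (intro sum.cong) auto
    finally show False using total by linarith
  qed
  \<comment> \<open>The assignment \<open>c\<close> gives a hyperedge to one template only, so
    matchings taken from different graphs \<open>Gc t\<close> cannot share a hyperedge.\<close>
  define Gc where "Gc t = {p \<in> I \<times> I. ed t p \<in> E \<and> c (ed t p) = t}" for t
  have "\<exists>\<sigma>. (\<forall>c<r. bij_betw (\<sigma> c) I I \<and> (\<forall>i\<in>I. (i, \<sigma> c i) \<in> Gc t)) \<and>
     (\<forall>c<r. \<forall>c'<r. c \<noteq> c' \<longrightarrow> (\<forall>i\<in>I. \<sigma> c i \<noteq> \<sigma> c' i))" if t: "t < N" for t
  proof (rule disjoint_matchings)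
    fix A B assume A: "A \<subseteq> I" and B: "B \<subseteq> I"
    show "r * (card A + card B) \<le> card (Gc t \<inter> A \<times> B) + r * card I"
    proof (cases "m < card A + card B")
      case True
      then have h: "(t, A, B) \<in> H" using t A B unfolding H_def by auto
      have "{e \<in> Q (t, A, B). c e = \<tau> (t, A, B)} \<subseteq> ed t ` (Gc t \<inter> A \<times> B)"
        using A B unfolding Q_def \<tau>_def Gc_def by auto
      then have "card {e \<in> Q (t, A, B). c e = \<tau> (t, A, B)} \<le> card (Gc t \<inter> A \<times> B)"
        by (rule surj_card_le[rotated]) (use finI in \<open>auto simp: Gc_def\<close>)
      then have "r * (card A + card B - m) \<le> card (Gc t \<inter> A \<times> B)"
        using many[OF h] unfolding T_def by simp
      moreover have "r * (card A + card B) = r * (card A + card B - m) + r * m"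
        using True by (simp flip: distrib_left)
      ultimately show ?thesis using cI by simp
    next
      case False
      then have "r * (card A + card B) \<le> r * m" by (intro mult_le_mono2) simp
      then show ?thesis unfolding cI by (rule trans_le_add2)
    qed
  qed (use finI in \<open>auto simp: Gc_def\<close>)
  then obtain \<sigma> where \<sigma>: "\<And>t c. t < N \<Longrightarrow> c < r \<Longrightarrow> bij_betw (\<sigma> t c) I I \<and> (\<forall>i\<in>I. (i, \<sigma> t c i) \<in> Gc t)"
    and ne: "\<And>t c c' i. t < N \<Longrightarrow> c < r \<Longrightarrow> c' < r \<Longrightarrow> c \<noteq> c' \<Longrightarrow> i \<in> I \<Longrightarrow> \<sigma> t c i \<noteq> \<sigma> t c' i"
    by metis
  have inE: "ed t (i, \<sigma> t b i) \<in> E \<and> c (ed t (i, \<sigma> t b i)) = t \<and> \<sigma> t b i < m"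
    if "t < N" "b < r" "i < m" for t b i
    using \<sigma>[OF that(1,2)] that(3) unfolding Gc_def I_def by auto
  have dis: "ed t (i, \<sigma> t b i) \<noteq> ed t' (i', \<sigma> t' b' i')"
    if *: "t < N" "b < r" "t' < N" "b' < r" "(t, b) \<noteq> (t', b')" "i < m" "i' < m" for t b t' b' i i'
  proof
    assume eq: "ed t (i, \<sigma> t b i) = ed t' (i', \<sigma> t' b' i')"
    then have tt: "t = t'" using inE[OF *(1,2,6)] inE[OF *(3,4,7)] by auto
    then have "(i, \<sigma> t b i) = (i', \<sigma> t b' i')"
      using eq inj_onD[OF inj[OF *(1)], of "(i, \<sigma> t b i)" "(i', \<sigma> t b' i')"] inE[OF *(1,2,6)] inE[OF *(3,4,7)] *
      by auto
    then show False using ne[OF *(1,2), of b' i] * tt unfolding I_def by auto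
  qed
  show ?thesis
    by (rule exI[of _ \<sigma>]) (use \<sigma> inE dis in \<open>auto simp: I_def\<close>)
qed

text \<open>The templates are drawn from good arrangements only. These form a fraction of at least 1
  - \<delta>, so the restriction raises covering probabilities at most by the factor 1 / (1 -
  \<delta>) that appears in \<rho>. Balancing is done over all k-sets, whether they are edges or
  not, which brings the binomial coefficient into the bound for q.\<close>

lemma hamilton_packing:
  fixes \<alpha> \<alpha>' q \<rho> \<delta> \<eta> :: real and d l m N r z :: nat
  assumes d: "d \<ge> 2" and l: "l \<le> d - 1" and m: "m \<ge> 3"
    and H: "uniform_hypergraph (d + l) V E" and V: "card V = d * m"
    and \<alpha>: "1 / 2 < \<alpha>'" "\<alpha>' < \<alpha>" "\<alpha> \<le> 1"
    and z: "\<alpha> * m \<le> real m - z"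
    and good: "card {f \<in> arrangements (d * m) V. \<not> good_arrangement d l m E z f}
      \<le> \<delta> * card (arrangements (d * m) V)" and \<delta>: "\<delta> < 1"
    and \<rho>: "\<rho> = real (m * m) / ((1 - \<delta>) * (d * m choose (d + l)))"
    and \<eta>: "0 < \<eta>" "\<eta> < 1"
    and q: "1 \<le> q" "(ln (d * m choose (d + l)) / \<eta> + \<rho> * N) / (1 - \<eta>) \<le> q"
    and r: "q * r \<le> f_reg \<alpha>' * m"
    and small: "12 * N * (m * exp (- ((\<alpha> - \<alpha>')\<^sup>2 / 16) * m / q)) < 1"
      "m * exp (- ((\<alpha> - \<alpha>')\<^sup>2 / 16) * m / q) \<le> 1"
  shows "\<exists>\<C>. (\<forall>C\<in>\<C>. hamilton_cycle (d + l) l V E C) \<and> pairwise disjnt \<C> \<and> card \<C> = N * r"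
proof -
  let ?\<Omega> = "arrangements (d * m) V" and ?k = "d + l" and ?I = "{..<m}"
  have finV: "finite V" and E: "\<And>e. e \<in> E \<Longrightarrow> e \<subseteq> V \<and> card e = ?k"
    using H unfolding uniform_hypergraph_def by auto
  have finE: "finite E" by (rule finite_subset[of _ "Pow V"]) (use E finV in auto)
  define cov where "cov f = (\<lambda>(i, y). f ` edge_positions d l m i y)" for f :: "nat \<Rightarrow> 'a"
  define P where "P = {f \<in> ?\<Omega>. good_arrangement d l m E z f}"
  define K where "K = {e. e \<subseteq> V \<and> card e = ?k}"
  have fin\<Omega>: "finite ?\<Omega>" and ne: "card ?\<Omega> > 0"
    using finite_arrangements[OF finV] arrangements_nonempty[OF finV V] by (auto simp: card_gt_0_iff)
  have finP: "finite P" unfolding P_def using fin\<Omega> by simp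
  have "card ?\<Omega> = card P + card {f \<in> ?\<Omega>. \<not> good_arrangement d l m E z f}"
    unfolding P_def using fin\<Omega> by (subst card_Un_disjoint[symmetric]) (auto intro: arg_cong[of _ _ card])
  then have cP: "(1 - \<delta>) * card ?\<Omega> \<le> card P" using good by (simp add: algebra_simps)
  have "0 < (1 - \<delta>) * card ?\<Omega>" using ne \<delta> by simp
  then have P0: "P \<noteq> {}" using cP by auto
  have cK: "card K = (d * m choose ?k)" unfolding K_def using n_subsets[OF finV] V by simp
  have finK: "finite K" unfolding K_def using finV by simp
  have choose0: "real (d * m choose ?k) > 0"
    using grid_le_binomial[OF d l m] m by (metis gr0I le_zero_eq mult_is_0 not_numeral_le_zero of_nat_0_less_iff)
  have covP: "card {f \<in> P. e \<in> cov f ` (?I \<times> ?I)} \<le> \<rho> * card P" if e: "e \<in> K" for e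
  proof -
    have "card {f \<in> P. e \<in> cov f ` (?I \<times> ?I)} \<le> card {f \<in> ?\<Omega>. e \<in> cov f ` (?I \<times> ?I)}"
      unfolding P_def using fin\<Omega> by (intro card_mono) auto
    then have "(d * m choose ?k) * card {f \<in> P. e \<in> cov f ` (?I \<times> ?I)} \<le>
        (d * m choose ?k) * card {f \<in> ?\<Omega>. e \<in> cov f ` (?I \<times> ?I)}" by (rule mult_le_mono2)
    also have "\<dots> \<le> m * m * card ?\<Omega>"
      unfolding cov_def using card_arrangements_covering_le[OF d l m finV V] e K_def by auto
    finally have "real (d * m choose ?k) * card {f \<in> P. e \<in> cov f ` (?I \<times> ?I)} \<le> real (m * m) * card ?\<Omega>"
      by (simp only: of_nat_le_iff flip: of_nat_mult)
    also have "\<dots> \<le> real (m * m) * (card P / (1 - \<delta>))"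
      using cP \<delta> by (intro mult_left_mono) (auto simp: field_simps)
    finally show ?thesis
      unfolding \<rho> using choose0 \<delta> by (simp add: field_simps)
  qed
  obtain p where p: "\<And>t. p t \<in> P" and
    bal: "\<And>e. e \<in> K \<Longrightarrow> real (card {t. t < N \<and> e \<in> cov (p t) ` (?I \<times> ?I)}) \<le> (ln (card K) / \<eta> + \<rho> * N) / (1 - \<eta>)"
    using balanced_sequence[of P K \<eta> "\<lambda>f. cov f ` (?I \<times> ?I)" \<rho> N] finP P0 finK \<eta> covP by blast
  have p\<Omega>: "p t \<in> ?\<Omega>" and pg: "good_arrangement d l m E z (p t)" for t using p[of t] unfolding P_def by auto
  have pb: "inj_on (p t) {..<d * m}" for t using p\<Omega>[of t] unfolding arrangements_def by (auto simp: bij_betw_def)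
  have inj: "inj_on (cov (p t)) (?I \<times> ?I)" for t
  proof (rule inj_onI, clarsimp simp: cov_def)
    fix i y i' y' assume *: "i < m" "y < m" "i' < m" "y' < m"
      "p t ` edge_positions d l m i y = p t ` edge_positions d l m i' y'"
    then have "edge_positions d l m i y = edge_positions d l m i' y'"
      using inj_on_image_eq_iff[OF pb[of t]] edge_positions_subset[OF d l m] by auto
    then show "i = i' \<and> y = y'" using edge_positions_inject[OF d l m] * by auto
  qed
  \<comment> \<open>Ignoring the index m - 1 costs nothing: fewer than z failures means at most z -
    1, and (m - 1) - (z - 1) = m - z.\<close>
  have complement: "real m - z \<le> card {x. x < m \<and> X x}" if "card {x \<in> {..<m - 1}. \<not> X x} < z" for X
  proof -
    have "m - 1 = card {..<m - 1}" by simp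
    also have "{..<m - 1} = {x \<in> {..<m - 1}. X x} \<union> {x \<in> {..<m - 1}. \<not> X x}" by auto
    also have "card \<dots> \<le> card {x \<in> {..<m - 1}. X x} + card {x \<in> {..<m - 1}. \<not> X x}" by (rule card_Un_le)
    also have "card {x \<in> {..<m - 1}. X x} \<le> card {x. x < m \<and> X x}" by (intro card_mono) auto
    finally show ?thesis using that by simp
  qed
  have row: "\<alpha> * m \<le> card {y. y < m \<and> cov (p t) (i, y) \<in> E}" if "i < m" for t i
  proof -
    have "card {y \<in> {..<m - 1}. cov (p t) (i, y) \<notin> E} \<le> card {y \<in> {..<m}. cov (p t) (i, y) \<notin> E}"
      by (intro card_mono) auto
    also have "\<dots> < z" using pg[of t] that unfolding good_arrangement_def cov_def by simp
    finally show ?thesis using complement[of "\<lambda>y. cov (p t) (i, y) \<in> E"] z by linarith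
  qed
  have col: "\<alpha> * m \<le> card {i. i < m \<and> cov (p t) (i, y) \<in> E}" if "y < m" for t y
  proof -
    have "card {i \<in> {..<m - 1}. cov (p t) (i, y) \<notin> E} < z"
      using pg[of t] that unfolding good_arrangement_def cov_def by simp
    then show ?thesis using complement[of "\<lambda>i. cov (p t) (i, y) \<in> E"] z by linarith
  qed
  have "\<exists>\<sigma>. (\<forall>t<N. \<forall>c<r. bij_betw (\<sigma> t c) ?I ?I) \<and>
    (\<forall>t<N. \<forall>c<r. \<forall>i<m. cov (p t) (i, \<sigma> t c i) \<in> E) \<and>
    (\<forall>t<N. \<forall>c<r. \<forall>t'<N. \<forall>c'<r. (t, c) \<noteq> (t', c') \<longrightarrow>
       (\<forall>i<m. \<forall>i'<m. cov (p t) (i, \<sigma> t c i) \<noteq> cov (p t') (i', \<sigma> t' c' i')))"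
  proof (rule template_matchings[OF \<alpha> finE inj row col q(1) _ r small])
    fix e assume "e \<in> E"
    then have "e \<in> K" using E unfolding K_def by auto
    from order_trans[OF bal[OF this]] show "card {t. t < N \<and> e \<in> cov (p t) ` (?I \<times> ?I)} \<le> q"
      using q(2) cK by simp
  qed
  then obtain \<sigma> where \<sigma>: "\<forall>t<N. \<forall>c<r. bij_betw (\<sigma> t c) ?I ?I"
    and \<sigma>E: "\<forall>t<N. \<forall>c<r. \<forall>i<m. cov (p t) (i, \<sigma> t c i) \<in> E"
    and \<sigma>d: "\<forall>t<N. \<forall>c<r. \<forall>t'<N. \<forall>c'<r. (t, c) \<noteq> (t', c') \<longrightarrow>
       (\<forall>i<m. \<forall>i'<m. cov (p t) (i, \<sigma> t c i) \<noteq> cov (p t') (i', \<sigma> t' c' i'))"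
    by (elim exE conjE) (rule that)
  define cyc where "cyc = (\<lambda>(t, c). (\<lambda>i. cov (p t) (i, \<sigma> t c i)) ` ?I)"
  define S where "S = {..<N} \<times> {..<r}"
  have ham: "hamilton_cycle ?k l V E (cyc x)" if xS: "x \<in> S" for x
  proof -
    obtain t c where x: "x = (t, c)" "t < N" "c < r" using xS unfolding S_def by auto
    show ?thesis
      using hamilton_cycle_of_matching[OF d l m H p\<Omega>[of t], of "\<sigma> t c"] \<sigma> \<sigma>E x(2,3)
      unfolding x(1) cyc_def cov_def by simp
  qed
  have dis: "disjnt (cyc x) (cyc x')" if "x \<in> S" "x' \<in> S" "x \<noteq> x'" for x x'
  proof -
    obtain t c t' c' where x: "x = (t, c)" "x' = (t', c')" by (meson surj_pair)
    have "cov (p t) (i, \<sigma> t c i) \<noteq> cov (p t') (i', \<sigma> t' c' i')" if "i < m" "i' < m" for i i'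
      using \<sigma>d that \<open>x \<in> S\<close> \<open>x' \<in> S\<close> \<open>x \<noteq> x'\<close> unfolding S_def x by blast
    then show ?thesis unfolding x cyc_def disjnt_def by auto
  qed
  \<comment> \<open>No cycle is empty, so disjoint cycles are different and the family really has N
    * r members.\<close>
  have "inj_on cyc S"
  proof (rule inj_onI, rule ccontr)
    fix x x' assume "x \<in> S" "x' \<in> S" "cyc x = cyc x'" "x \<noteq> x'"
    then have "cyc x = {}" using dis[of x x'] unfolding disjnt_def by auto
    then show False using m unfolding cyc_def by (auto simp: lessThan_empty_iff split: prod.splits)
  qed
  then have "card (cyc ` S) = N * r" unfolding S_def by (simp add: card_image card_cartesian_product)
  moreover have "pairwise disjnt (cyc ` S)"
    using dis unfolding pairwise_def by (metis imageE)
  ultimately show ?thesis using ham by (intro exI[of _ "cyc ` S"]) auto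
qed

text \<open>Here x stands for m, D x for n, and the quotient by 1 - \<epsilon> for an upper bound on
  q. In order, the conditions make bad arrangements rare, absorb rounding in the degree threshold,
  make the logarithmic loss negligible against sqrt n, make q so small against \<phi> m that
  rounding r is cheap, and let exp(- c m / q) beat 24 n^(k + 2).\<close>

lemma eventually_parameters:
  fixes \<theta> \<eta> D K \<epsilon> \<phi> c :: real
  assumes "\<theta> > 0" "\<eta> > 0" "D \<ge> 1" "K > 0" "0 < \<epsilon>" "\<epsilon> < 1" "\<phi> > 0" "c > 0"
  shows "\<forall>\<^sub>F x :: real in at_top. 2 * x * exp (- \<theta> * (\<eta> * x - 1)) \<le> \<epsilon>"
    "\<forall>\<^sub>F x :: real in at_top. 1 / x \<le> \<eta>"
    "\<forall>\<^sub>F x :: real in at_top. K * ln (D * x) / \<epsilon> \<le> \<epsilon> * sqrt (D * x)"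
    "\<forall>\<^sub>F x :: real in at_top. (K * ln (D * x) / \<epsilon> + sqrt (D * x) + 2) / (1 - \<epsilon>) \<le> \<epsilon> * (\<phi> * x)"
    "\<forall>\<^sub>F x :: real in at_top. ln 24 + (K + 2) * ln (D * x) < c * x / ((K * ln (D * x) / \<epsilon> + sqrt (D * x) + 2) / (1 - \<epsilon>))"
proof -
  have D: "D > 0" and e: "1 - \<epsilon> > 0" using assms by auto
  have K2: "K + 2 > 0" using assms by auto
  have "((\<lambda>x. 2 * x * exp (- \<theta> * (\<eta> * x - 1))) \<longlongrightarrow> 0) at_top"
    using assms by real_asymp
  from order_tendstoD(2)[OF this \<open>0 < \<epsilon>\<close>]
  show "\<forall>\<^sub>F x :: real in at_top. 2 * x * exp (- \<theta> * (\<eta> * x - 1)) \<le> \<epsilon>"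
    by (rule eventually_mono) simp
  show "\<forall>\<^sub>F x :: real in at_top. 1 / x \<le> \<eta>" using assms by real_asymp
  have "((\<lambda>x. K * ln (D * x) / \<epsilon> / sqrt (D * x)) \<longlongrightarrow> 0) at_top"
    using assms D by real_asymp
  from order_tendstoD(2)[OF this \<open>0 < \<epsilon>\<close>] eventually_gt_at_top[of 0]
  show "\<forall>\<^sub>F x :: real in at_top. K * ln (D * x) / \<epsilon> \<le> \<epsilon> * sqrt (D * x)"
  proof eventually_elim
    case (elim x)
    moreover have "sqrt (D * x) > 0" using D elim by simp
    ultimately show ?case by (simp only: pos_divide_less_eq less_imp_le)
  qed
  have "((\<lambda>x. (K * ln (D * x) / \<epsilon> + sqrt (D * x) + 2) / (1 - \<epsilon>) / x) \<longlongrightarrow> 0) at_top"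
    using assms D e by real_asymp
  moreover have "\<epsilon> * \<phi> > 0" using assms by simp
  ultimately have "\<forall>\<^sub>F x in at_top. (K * ln (D * x) / \<epsilon> + sqrt (D * x) + 2) / (1 - \<epsilon>) / x < \<epsilon> * \<phi>"
    by (rule order_tendstoD(2))
  with eventually_gt_at_top[of 0]
  show "\<forall>\<^sub>F x :: real in at_top. (K * ln (D * x) / \<epsilon> + sqrt (D * x) + 2) / (1 - \<epsilon>) \<le> \<epsilon> * (\<phi> * x)"
  proof eventually_elim
    case (elim x)
    then show ?case by (simp only: pos_divide_less_eq mult.assoc less_imp_le)
  qed
  show "\<forall>\<^sub>F x :: real in at_top. ln 24 + (K + 2) * ln (D * x) < c * x / ((K * ln (D * x) / \<epsilon> + sqrt (D * x) + 2) / (1 - \<epsilon>))"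
    using assms D e K2 by real_asymp
qed

theorem theorem1p2:
  fixes k l :: nat and \<alpha> \<alpha>' :: real
  assumes "k \<ge> 2" and "real l < real k / 2"
    and "1 / 2 < \<alpha>'" and "\<alpha>' < \<alpha>" and "\<alpha> \<le> 1"
  shows "\<forall>\<gamma>>0. \<exists>n0. \<forall>n\<ge>n0. \<forall>(V :: 'a set) E.
    (k - l) dvd n \<and> uniform_hypergraph k V E \<and> card V = n \<and>
    real (min_hdegree (k - 1) V E) \<ge> \<alpha> * real n \<longrightarrow>
    (\<exists>\<C>. (\<forall>C\<in>\<C>. hamilton_cycle k l V E C) \<and> pairwise disjnt \<C> \<and>
      real (card \<C>) \<ge> (1 - \<gamma>) * (f_reg \<alpha>' * real (card E) / (real n / real (k - l))))"
proof (intro allI impI)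
  fix \<gamma> :: real assume \<gamma>: "\<gamma> > 0"
  define d where "d = k - l"
  have lk: "2 * l < k" using assms(2) by linarith
  then have k: "k = d + l" and d: "d \<ge> 2" and l: "l \<le> d - 1" using assms(1) unfolding d_def by auto
  \<comment> \<open>The losses combine to (1 - \<epsilon>)^3 / (1 + \<epsilon>), which is at least 1
    - 4 \<epsilon>. The minimum keeps \<epsilon> at most 1 / 4 when \<gamma> is large.\<close>
  define \<epsilon> where "\<epsilon> = min \<gamma> 1 / 4"
  have \<epsilon>: "0 < \<epsilon>" "\<epsilon> < 1" "\<epsilon> \<le> 1 / 4" "4 * \<epsilon> \<le> \<gamma>" unfolding \<epsilon>_def using \<gamma> by auto
  \<comment> \<open>The midpoint divides the gap: the step from \<alpha> to \<beta> pays for degree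
    deviations in random templates, the step from \<beta> to \<alpha>' for the surplus in
    cuts.\<close>
  define \<beta> where "\<beta> = (\<alpha> + \<alpha>') / 2"
  have \<beta>: "1 / 2 < \<alpha>'" "\<alpha>' < \<beta>" "\<beta> \<le> 1" "\<beta> < \<alpha>" "\<beta> > 0" unfolding \<beta>_def using assms by auto
  define \<phi> where "\<phi> = f_reg \<alpha>'"
  have \<phi>: "0 < \<phi>" unfolding \<phi>_def using assms by (intro f_reg_bounds) auto
  define \<theta> where "\<theta> = 1 - (1 - \<alpha>) / (1 - (\<alpha> + \<beta>) / 2)"
  define \<eta> where "\<eta> = (\<alpha> - \<beta>) / (2 * (2 * d + l + 1))"
  define c where "c = (\<beta> - \<alpha>')\<^sup>2 / 16"
  have \<theta>: "\<theta> > 0" unfolding \<theta>_def using \<beta> assms(5) by (simp add: field_simps)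
  have \<eta>: "\<eta> > 0" unfolding \<eta>_def using \<beta> by simp
  have c: "c > 0" unfolding c_def using \<beta> by simp
  \<comment> \<open>An upper bound for q in terms of m alone; the summand 2 covers rounding N up,
    which adds at most \<rho> \<le> 2 to \<rho> N.\<close>
  define Qm where "Qm x = (real k * ln (real d * x) / \<epsilon> + sqrt (real d * x) + 2) / (1 - \<epsilon>)" for x :: real
  note ev = eventually_parameters[of \<theta> \<eta> "real d" "real k" \<epsilon> \<phi> c]
  have "\<forall>\<^sub>F x :: real in at_top. 2 * x * exp (- \<theta> * (\<eta> * x - 1)) \<le> \<epsilon> \<and> 1 / x \<le> \<eta> \<and>
      real k * ln (real d * x) / \<epsilon> \<le> \<epsilon> * sqrt (real d * x) \<and> Qm x \<le> \<epsilon> * (\<phi> * x) \<and>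
      ln 24 + (real k + 2) * ln (real d * x) < c * x / Qm x"
    unfolding Qm_def using \<theta> \<eta> d \<epsilon> \<phi> c assms(1) by (intro eventually_conj ev) auto
  then obtain X where X: "\<And>x. x \<ge> X \<Longrightarrow> 2 * x * exp (- \<theta> * (\<eta> * x - 1)) \<le> \<epsilon> \<and> 1 / x \<le> \<eta> \<and>
      real k * ln (real d * x) / \<epsilon> \<le> \<epsilon> * sqrt (real d * x) \<and> Qm x \<le> \<epsilon> * (\<phi> * x) \<and>
      ln 24 + (real k + 2) * ln (real d * x) < c * x / Qm x"
    unfolding eventually_at_top_linorder by blast
  define m0 where "m0 = max 3 (nat \<lceil>X\<rceil>)"
  show "\<exists>n0. \<forall>n\<ge>n0. \<forall>(V :: 'a set) E.
    (k - l) dvd n \<and> uniform_hypergraph k V E \<and> card V = n \<and>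
    real (min_hdegree (k - 1) V E) \<ge> \<alpha> * real n \<longrightarrow>
    (\<exists>\<C>. (\<forall>C\<in>\<C>. hamilton_cycle k l V E C) \<and> pairwise disjnt \<C> \<and>
      real (card \<C>) \<ge> (1 - \<gamma>) * (f_reg \<alpha>' * real (card E) / (real n / real (k - l))))"
  proof (intro exI[of _ "d * m0"] allI impI)
    fix n and V :: "'a set" and E
    assume n0: "d * m0 \<le> n"
    assume "(k - l) dvd n \<and> uniform_hypergraph k V E \<and> card V = n \<and>
      real (min_hdegree (k - 1) V E) \<ge> \<alpha> * real n"
    then have "d dvd n" and H: "uniform_hypergraph (d + l) V E" and Vn: "card V = n"
      and deg0: "\<alpha> * real n \<le> min_hdegree (k - 1) V E" unfolding d_def[symmetric] k by auto
    then obtain m where n: "n = d * m" by (auto simp: dvd_def)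
    have mm0: "m0 \<le> m" using n0 d unfolding n by simp
    then have m: "m \<ge> 3" and mX: "real m \<ge> X" unfolding m0_def by linarith+
    have V: "card V = d * m" using Vn n by simp
    have finV: "finite V" using H unfolding uniform_hypergraph_def by simp
    note Xm = X[OF mX]
    have m_pos: "real m > 0" and n_pos: "real n > 0" using m d n by auto
    have dm: "real d * real m = real n" using n by simp
    have deg: "\<alpha> * card V \<le> hdegree E A" if "A \<subseteq> V" "card A = d + l - 1" for A
    proof -
      have "min_hdegree (k - 1) V E \<le> hdegree E A"
        unfolding min_hdegree_def using that finV k by (intro Min_le) auto
      then show ?thesis using deg0 Vn by simp
    qed
    define z where "z = nat \<lfloor>(1 - \<beta>) * m\<rfloor>"
    have "real z \<le> (1 - \<beta>) * m" unfolding z_def using \<beta> by simp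
    then have z: "\<beta> * m \<le> real m - z" by (simp add: algebra_simps)
    have good: "card {f \<in> arrangements (d * m) V. \<not> good_arrangement d l m E z f}
      \<le> \<epsilon> * card (arrangements (d * m) V)"
      unfolding z_def
      by (rule bad_arrangements_fraction[OF d l m H V deg \<beta>(4) assms(5) \<eta>_def \<beta>(5)])
        (use Xm \<theta>_def in auto)
    define b where "b = real (d * m choose (d + l))"
    have bm: "real (m * m) \<le> b" unfolding b_def by (rule of_nat_mono[OF grid_le_binomial[OF d l m]])
    have b_pos: "b > 0" using bm m_pos by (simp add: less_le_trans[of 0 "real m * real m"])
    have bn: "b \<le> real n ^ k"
    proof -
      have "(n choose k) * 1 \<le> (n choose k) * fact k" by (intro mult_le_mono2 fact_ge_1)
      also have "\<dots> \<le> n ^ k" by (rule binomial_fact_pow)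
      finally have "real (n choose k) \<le> real (n ^ k)" by simp
      then show ?thesis unfolding b_def k n by simp
    qed
    define \<rho> where "\<rho> = real (m * m) / ((1 - \<epsilon>) * b)"
    have \<rho>: "0 < \<rho>" "\<rho> \<le> 2"
    proof -
      show "0 < \<rho>" unfolding \<rho>_def using b_pos \<epsilon> m_pos by simp
      have "0 \<le> (1 - 2 * \<epsilon>) * b" using b_pos \<epsilon> by simp
      then have "b \<le> 2 * ((1 - \<epsilon>) * b)" by (simp add: algebra_simps)
      then have "real (m * m) \<le> 2 * ((1 - \<epsilon>) * b)" using bm by linarith
      then show "\<rho> \<le> 2" unfolding \<rho>_def using b_pos \<epsilon> by (simp add: divide_le_eq)
    qed
    define N where "N = nat \<lceil>sqrt n / \<rho>\<rceil>"
    have N: "sqrt n / \<rho> \<le> N" "N \<le> sqrt n / \<rho> + 1"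
      unfolding N_def using \<rho>(1) by (auto intro: real_nat_ceiling_ge)
    then have \<rho>N: "sqrt n \<le> \<rho> * N" "\<rho> * N \<le> sqrt n + 2"
      using \<rho> by (auto simp: field_simps)
    define L where "L = real k * ln n / \<epsilon>"
    define q where "q = (L + \<rho> * N) / (1 - \<epsilon>)"
    have n1: "real n \<ge> 1" using n_pos by simp
    have L0: "L \<ge> 0" unfolding L_def using n1 \<epsilon> by simp
    have LN: "L \<le> \<epsilon> * (\<rho> * N)"
    proof -
      have "L \<le> \<epsilon> * sqrt n" using Xm unfolding L_def dm by simp
      also have "\<dots> \<le> \<epsilon> * (\<rho> * N)" using \<rho>N \<epsilon> by (intro mult_left_mono) auto
      finally show ?thesis .
    qed
    have "sqrt n \<ge> 1" using n1 by simp
    then have RN1: "1 \<le> \<rho> * N" using \<rho>N(1) by linarith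
    have N_pos: "real N > 0" using RN1 \<rho>(1) by (cases "N = 0") auto
    have "\<rho> * N \<le> L + \<rho> * N" using L0 by simp
    also have "\<dots> \<le> q" unfolding q_def using \<epsilon> L0 RN1 by (simp add: le_divide_eq mult_left_le)
    finally have q1: "1 \<le> q" using RN1 by linarith
    have qQ: "q \<le> Qm m" unfolding q_def Qm_def dm L_def[symmetric] using \<rho>N \<epsilon> by (intro divide_right_mono) auto
    have qN: "q \<le> (1 + \<epsilon>) / (1 - \<epsilon>) * (\<rho> * N)"
      unfolding q_def using LN \<epsilon> by (simp add: divide_right_mono algebra_simps)
    have q2: "(ln (d * m choose (d + l)) / \<epsilon> + \<rho> * N) / (1 - \<epsilon>) \<le> q"
    proof -
      have "ln b \<le> ln (real n ^ k)" using bn b_pos n_pos by (subst ln_le_cancel_iff) auto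
      also have "\<dots> = k * ln n" using n_pos by (simp add: ln_realpow)
      finally have "ln b / \<epsilon> \<le> L" unfolding L_def using \<epsilon> by (intro divide_right_mono) auto
      then show ?thesis unfolding q_def b_def[symmetric] using \<epsilon> by (intro divide_right_mono) auto
    qed
    define r where "r = nat \<lfloor>\<phi> * m / q\<rfloor>"
    have r0: "\<phi> * m / q \<ge> 0" using \<phi> q1 by simp
    have rle: "q * r \<le> \<phi> * m"
    proof -
      have "r \<le> \<phi> * m / q" unfolding r_def using r0 by simp
      then show ?thesis using q1 by (simp add: field_simps)
    qed
    have rge: "(1 - \<epsilon>) * (\<phi> * m / q) \<le> r"
    proof -
      have "q \<le> \<epsilon> * (\<phi> * m)" using qQ Xm by simp
      then have "1 \<le> \<epsilon> * (\<phi> * m / q)" using q1 by (simp add: field_simps)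
      moreover have "\<phi> * m / q - 1 \<le> r" unfolding r_def using r0 by linarith
      moreover have "(1 - \<epsilon>) * (\<phi> * m / q) = \<phi> * m / q - \<epsilon> * (\<phi> * m / q)"
        by (simp only: left_diff_distrib mult_1)
      ultimately show ?thesis by linarith
    qed
    define F where "F = exp (- ((\<beta> - \<alpha>')\<^sup>2 / 16) * m / q)"
    have small: "24 * real n ^ (k + 1) * (m * F) < 1"
    proof -
      have "c * m / Qm m \<le> c * m / q" using qQ q1 c by (intro divide_left_mono) auto
      then have lt: "ln 24 + (real k + 2) * ln n < c * m / q" using Xm unfolding dm by linarith
      have "m \<le> n" unfolding n using d by simp
      then have "real m \<le> n" by simp
      then have "24 * real n ^ (k + 1) * (m * F) \<le> 24 * real n ^ (k + 1) * (n * F)"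
        unfolding F_def by (intro mult_left_mono mult_right_mono) auto
      also have "\<dots> = 24 * real n ^ (k + 2) * F" by simp
      also have "real n ^ (k + 2) = exp ((real k + 2) * ln n)"
        using exp_of_nat2_mult[of "ln (real n)" "k + 2"] n_pos by (simp add: mult.commute add.commute)
      also have "24 * exp ((real k + 2) * ln n) * F = exp (ln 24 + (real k + 2) * ln n - c * m / q)"
      proof -
        have "exp (ln 24 + (real k + 2) * ln n - c * m / q)
            = exp (ln 24) * exp ((real k + 2) * ln n) * exp (- (c * m / q))"
          by (simp only: diff_conv_add_uminus exp_add)
        moreover have "F = exp (- (c * m / q))" unfolding F_def c_def by simp
        ultimately show ?thesis by simp
      qed
      also have "\<dots> < 1" using lt by simp
      finally show ?thesis .
    qed
    have F0: "m * F \<ge> 0" unfolding F_def by simp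
    \<comment> \<open>The number of templates is polynomial in n: 1 / \<rho> \<le> b \<le> n^k and
      sqrt n \<le> n, while rounding up adds at most 1, giving N \<le> 2 n^(k + 1).\<close>
    have NN: "12 * real N \<le> 24 * real n ^ (k + 1)"
    proof -
      have "1 / \<rho> \<le> b"
      proof -
        have "1 / \<rho> = (1 - \<epsilon>) * b / real (m * m)" unfolding \<rho>_def by simp
        also have "\<dots> \<le> (1 - \<epsilon>) * b / 1"
        proof (rule divide_left_mono)
          have "1 * 1 \<le> real m * real m" using m by (intro mult_mono) auto
          then show "1 \<le> real (m * m)" by simp
        qed (use \<epsilon> b_pos m_pos in auto)
        also have "\<dots> \<le> b" using \<epsilon> b_pos by (simp add: mult_left_le_one_le)
        finally show ?thesis .
      qed
      moreover have "sqrt n \<le> n" using n1 real_sqrt_le_mono[of "real n" "real n * real n"]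
        by (simp add: real_sqrt_mult_self mult_left_le)
      ultimately have "sqrt n * (1 / \<rho>) \<le> n * b" using b_pos \<rho> by (intro mult_mono) auto
      also have "\<dots> \<le> n * real n ^ k" using bn by (intro mult_left_mono) auto
      finally have "sqrt n / \<rho> \<le> real n ^ (k + 1)" by simp
      moreover have "1 \<le> real n ^ (k + 1)" using n1 by (rule one_le_power)
      ultimately show ?thesis using N(2) by linarith
    qed
    have small1: "12 * N * (m * F) < 1"
    proof -
      have "12 * N * (m * F) \<le> 24 * real n ^ (k + 1) * (m * F)" using NN F0 by (intro mult_right_mono) auto
      then show ?thesis using small by linarith
    qed
    have small2: "m * F \<le> 1"
    proof -
      have "1 \<le> real n ^ (k + 1)" using n1 by (rule one_le_power)
      then have "1 * (m * F) \<le> 24 * real n ^ (k + 1) * (m * F)" using F0 by (intro mult_right_mono) auto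
      then show ?thesis using small by linarith
    qed
    obtain \<C> where \<C>: "\<forall>C\<in>\<C>. hamilton_cycle (d + l) l V E C" "pairwise disjnt \<C>" "card \<C> = N * r"
      using hamilton_packing[OF d l m H V \<beta>(1-3) z good \<epsilon>(2) _ \<epsilon>(1,2) q1 q2, of r]
        \<rho>_def b_def rle small1 small2 unfolding \<phi>_def F_def by auto
    \<comment> \<open>The packing has size proportional to b, the number of all k-sets; the edge
      count is compared with it only here.\<close>
    have Eb: "real (card E) \<le> b"
    proof -
      have "card E \<le> card {e. e \<subseteq> V \<and> card e = d + l}"
        using H finV unfolding uniform_hypergraph_def by (intro card_mono) auto
      then show ?thesis unfolding b_def using n_subsets[OF finV] V by simp
    qed
    have "(1 - \<gamma>) * (\<phi> * card E / m) \<le> (1 - 4 * \<epsilon>) * (\<phi> * b / m)"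
    proof -
      have "(1 - \<gamma>) * (\<phi> * card E / m) \<le> (1 - 4 * \<epsilon>) * (\<phi> * card E / m)"
        using \<epsilon> \<phi> by (intro mult_right_mono) auto
      also have "\<dots> \<le> (1 - 4 * \<epsilon>) * (\<phi> * b / m)"
        using \<epsilon> \<phi> Eb by (intro mult_left_mono divide_right_mono) auto
      finally show ?thesis .
    qed
    \<comment> \<open>One factor 1 - \<epsilon> stems from rounding r, the quotient (1 - \<epsilon>)
      / (1 + \<epsilon>) from \<open>qN\<close>, and the remaining 1 - \<epsilon> from the
      conditioning inside \<rho>.\<close>
    also have "\<dots> \<le> (1 - \<epsilon>) ^ 3 / (1 + \<epsilon>) * (\<phi> * b / m)"
    proof (rule mult_right_mono)
      have "(1 - 4 * \<epsilon>) * (1 + \<epsilon>) \<le> (1 - \<epsilon>) ^ 3"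
      proof -
        have "(1 - \<epsilon>) ^ 3 - (1 - 4 * \<epsilon>) * (1 + \<epsilon>) = \<epsilon>\<^sup>2 * (7 - \<epsilon>)"
          by (simp add: power2_eq_square power3_eq_cube algebra_simps)
        also have "\<dots> \<ge> 0" using \<epsilon> by simp
        finally show ?thesis by simp
      qed
      then show "1 - 4 * \<epsilon> \<le> (1 - \<epsilon>) ^ 3 / (1 + \<epsilon>)" using \<epsilon> by (simp add: le_divide_eq)
    qed (use \<phi> b_pos in simp)
    also have "\<dots> = (1 - \<epsilon>) * (N * (\<phi> * m / ((1 + \<epsilon>) / (1 - \<epsilon>) * (\<rho> * N))))"
    proof -
      have "u ^ 3 / v * (\<phi> * b / m) = u * (N * (\<phi> * m / (v / u * (real (m * m) / (u * b) * N))))"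
        if "u > 0" "v > 0" for u v :: real
        using that b_pos m_pos N_pos by (simp add: field_simps power3_eq_cube)
      then show ?thesis unfolding \<rho>_def using \<epsilon> by simp
    qed
    also have "\<dots> \<le> (1 - \<epsilon>) * (N * (\<phi> * m / q))"
      using qN q1 \<epsilon> \<phi> RN1 by (intro mult_left_mono divide_left_mono) auto
    also have "\<dots> = N * ((1 - \<epsilon>) * (\<phi> * m / q))" by simp
    also have "\<dots> \<le> N * real r" using rge by (intro mult_left_mono) auto
    also have "\<dots> = card \<C>" using \<C>(3) by simp
    finally have "(1 - \<gamma>) * (\<phi> * card E / m) \<le> card \<C>" .
    moreover have "real n / real (k - l) = m" unfolding d_def[symmetric] n using d by simp
    ultimately show "\<exists>\<C>. (\<forall>C\<in>\<C>. hamilton_cycle k l V E C) \<and> pairwise disjnt \<C> \<and>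
      real (card \<C>) \<ge> (1 - \<gamma>) * (f_reg \<alpha>' * real (card E) / (real n / real (k - l)))"
      using \<C>(1,2) unfolding k[symmetric] \<phi>_def by auto
  qed
qed

end
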